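(* Let $T$ be a complete classical first-order theory and $\phi(x,y)$ a formula. The following are equivalent: (i) $\phi(x,y)$ has $NIP$. (ii) For any countable model $M$ of $T$ and saturated elementary extension $M^*$ of it, whenever $p(x)\in S_\phi(M^* )$ is finitely satisfiable in $M$, then it is $DBSC$ definable over $M$. (iii) For any countable model $M$ of $T$ and saturated elementary extension $M^*$ of it, the number of $p(x)\in S_\phi(M^* )$ which are finitely satisfiable in $M$ is $<2^{2^{\aleph_0}}$.
   Context: Classical formulas are treated as $\{0,1\}$-valued functions, with value $0$ meaning true and $1$ meaning false. Variables $x,y$ denote finite tuples. "Saturated" means in particular that all types over $M$ are realized in $M^*$. $NIP$ is the usual negation of the independence property for $\phi(x,y)$ in $T$. A complete $\phi$-type $p\in S_\phi(M^* )$ is identified with the function $b\mapsto\phi(p,b)\in\{0,1\}$ on $|y|$-tuples $b$ of $M^*$, where $\phi(p,b)=\phi(a,b)$ for any realization $a$ of $p$ in an elementary extension. It is finitely satisfiable in $M$ if for all $b_1,\dots,b_n\in M^*$ there is $a\in M$ with $\phi(p,b_i)=\phi(a,b_i)$ for all $i\le n$. Put $\tilde\phi(y,x)=\phi(x,y)$, and let $S_{\tilde\phi}(M)$ be the space of complete $\tilde\phi$-types over $M$ (functions $a\mapsto\phi(a,b)$ on $|x|$-tuples of $M$, $b$ in an elementary extension), with the weakest topology making all maps $q\mapsto\phi(a,q)$, $a\in M$, continuous; for $M$ countable it is compact metrizable. If $p$ is finitely satisfiable in $M$, then $\phi(p,b)$ depends only on $q=\mathrm{tp}_{\tilde\phi}(b/M)$,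 and one writes $\phi(p,q)$ for this value. For a compact metric space $X$, $DBSC(X)$ is the set of real-valued functions $F_1-F_2$ with $F_1,F_2$ bounded semi-continuous on $X$. A type $p\in S_\phi(M^* )$ finitely satisfiable in $M$ is $DBSC$ definable over $M$ if there is a sequence $(a_n)$ in $M$ such that the functions $\phi(a_n,y)$ on $S_{\tilde\phi}(M)$ converge pointwise to a $DBSC$ function $f$ with $\phi(p,q)=f(q)$ for all $q\in S_{\tilde\phi}(M)$.
   Formalization: The language of T is assumed countable: for uncountable languages the equivalence can fail (random graph with continuum many distinct named constants has IP but no countable model, so (ii), (iii) hold vacuously); "saturated" is read as ℵ1-saturated. *)

theory Defs
  imports "HOL-Analysis.Analysis" "HOL-Library.Equipollence"
begin

section \<open>Classical first-order logic\<close>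

record ('f, 'r) language =
  Funs :: "'f set"
  Rels :: "'r set"
  farity :: "'f \<Rightarrow> nat"
  rarity :: "'r \<Rightarrow> nat"

definition countable_language :: "('f, 'r) language \<Rightarrow> bool" where
  "countable_language L \<longleftrightarrow> countable (Funs L) \<and> countable (Rels L)"

datatype 'f trm = Var nat | Fun 'f "'f trm list"

datatype ('f, 'r) fm =
    Falsum
  | Equal "'f trm" "'f trm"
  | Rel 'r "'f trm list"
  | Imp "('f, 'r) fm" "('f, 'r) fm"
  | All nat "('f, 'r) fm"

fun is_term :: "('f, 'r) language \<Rightarrow> 'f trm \<Rightarrow> bool" where
  "is_term L (Var v) \<longleftrightarrow> True"
| "is_term L (Fun g ts) \<longleftrightarrow>
     g \<in> Funs L \<and> length ts = farity L g \<and> (\<forall>t\<in>set ts. is_term L t)"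

primrec is_formula :: "('f, 'r) language \<Rightarrow> ('f, 'r) fm \<Rightarrow> bool" where
  "is_formula L Falsum \<longleftrightarrow> True"
| "is_formula L (Equal s t) \<longleftrightarrow> is_term L s \<and> is_term L t"
| "is_formula L (Rel R ts) \<longleftrightarrow>
     R \<in> Rels L \<and> length ts = rarity L R \<and> (\<forall>t\<in>set ts. is_term L t)"
| "is_formula L (Imp \<psi> \<theta>) \<longleftrightarrow> is_formula L \<psi> \<and> is_formula L \<theta>"
| "is_formula L (All v \<psi>) \<longleftrightarrow> is_formula L \<psi>"

fun tvars :: "'f trm \<Rightarrow> nat set" where
  "tvars (Var v) = {v}"
| "tvars (Fun g ts) = (\<Union>t\<in>set ts. tvars t)"

primrec fv :: "('f, 'r) fm \<Rightarrow> nat set" where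
  "fv Falsum = {}"
| "fv (Equal s t) = tvars s \<union> tvars t"
| "fv (Rel R ts) = (\<Union>t\<in>set ts. tvars t)"
| "fv (Imp \<psi> \<theta>) = fv \<psi> \<union> fv \<theta>"
| "fv (All v \<psi>) = fv \<psi> - {v}"

definition is_sentence :: "('f, 'r) language \<Rightarrow> ('f, 'r) fm \<Rightarrow> bool" where
  "is_sentence L \<sigma> \<longleftrightarrow> is_formula L \<sigma> \<and> fv \<sigma> = {}"

text \<open>Only the values of the interpretations on tuples of the right length from the
  universe matter.\<close>

record ('f, 'r, 'u) struct =
  universe :: "'u set"
  fint :: "'f \<Rightarrow> 'u list \<Rightarrow> 'u"
  rint :: "'r \<Rightarrow> 'u list \<Rightarrow> bool"

definition tuples :: "nat \<Rightarrow> ('f, 'r, 'u) struct \<Rightarrow> 'u list set" where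
  "tuples n M = {c. length c = n \<and> set c \<subseteq> universe M}"

definition is_structure :: "('f, 'r) language \<Rightarrow> ('f, 'r, 'u) struct \<Rightarrow> bool" where
  "is_structure L M \<longleftrightarrow> universe M \<noteq> {} \<and>
     (\<forall>g\<in>Funs L. \<forall>c\<in>tuples (farity L g) M. fint M g c \<in> universe M)"

primrec tval :: "('f, 'r, 'u) struct \<Rightarrow> (nat \<Rightarrow> 'u) \<Rightarrow> 'f trm \<Rightarrow> 'u" where
  "tval M e (Var v) = e v"
| "tval M e (Fun g ts) = fint M g (map (tval M e) ts)"

primrec sat :: "('f, 'r, 'u) struct \<Rightarrow> (nat \<Rightarrow> 'u) \<Rightarrow> ('f, 'r) fm \<Rightarrow> bool" where
  "sat M e Falsum \<longleftrightarrow> False"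
| "sat M e (Equal s t) \<longleftrightarrow> tval M e s = tval M e t"
| "sat M e (Rel R ts) \<longleftrightarrow> rint M R (map (tval M e) ts)"
| "sat M e (Imp \<psi> \<theta>) \<longleftrightarrow> (sat M e \<psi> \<longrightarrow> sat M e \<theta>)"
| "sat M e (All v \<psi>) \<longleftrightarrow> (\<forall>d\<in>universe M. sat M (e(v := d)) \<psi>)"

definition is_model ::
    "('f, 'r) language \<Rightarrow> ('f, 'r) fm set \<Rightarrow> ('f, 'r, 'u) struct \<Rightarrow> bool" where
  "is_model L T M \<longleftrightarrow> is_structure L M \<and>
     (\<forall>\<sigma>\<in>T. \<forall>e. range e \<subseteq> universe M \<longrightarrow> sat M e \<sigma>)"

text \<open>Consequence refers to the models whose universe is a subset of the type \<open>'u\<close>.  For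
  a countable language and infinite \<open>'u\<close> this is the usual notion, by the downward
  Loewenheim-Skolem theorem.\<close>

definition entails ::
    "'u itself \<Rightarrow> ('f, 'r) language \<Rightarrow> ('f, 'r) fm set \<Rightarrow> ('f, 'r) fm \<Rightarrow> bool" where
  "entails _ L T \<sigma> \<longleftrightarrow>
     (\<forall>M :: ('f, 'r, 'u) struct. is_model L T M \<longrightarrow>
        (\<forall>e. range e \<subseteq> universe M \<longrightarrow> sat M e \<sigma>))"

definition complete_theory ::
    "'u itself \<Rightarrow> ('f, 'r) language \<Rightarrow> ('f, 'r) fm set \<Rightarrow> bool" where
  "complete_theory U L T \<longleftrightarrow>
     (\<forall>\<sigma>\<in>T. is_sentence L \<sigma>) \<and>
     \<not> entails U L T Falsum \<and>
     (\<forall>\<sigma>. is_sentence L \<sigma> \<longrightarrow> entails U L T \<sigma> \<or> entails U L T (Imp \<sigma> Falsum))"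

definition elementary_embedding ::
    "('f, 'r) language \<Rightarrow> ('u \<Rightarrow> 'v) \<Rightarrow> ('f, 'r, 'u) struct \<Rightarrow> ('f, 'r, 'v) struct \<Rightarrow> bool" where
  "elementary_embedding L h M N \<longleftrightarrow>
     is_structure L M \<and> is_structure L N \<and> h ` universe M \<subseteq> universe N \<and>
     (\<forall>\<psi> e. is_formula L \<psi> \<and> range e \<subseteq> universe M \<longrightarrow> (sat M e \<psi> \<longleftrightarrow> sat N (h \<circ> e) \<psi>))"

definition elementary_extension ::
    "('f, 'r) language \<Rightarrow> ('f, 'r, 'u) struct \<Rightarrow> ('f, 'r, 'u) struct \<Rightarrow> bool" where
  "elementary_extension L M N \<longleftrightarrow>
     universe M \<subseteq> universe N \<and> elementary_embedding L (\<lambda>u. u) M N"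

definition assign :: "(nat \<Rightarrow> 'u) \<Rightarrow> nat list \<Rightarrow> 'u list \<Rightarrow> nat \<Rightarrow> 'u" where
  "assign e vs c = (\<lambda>v. case map_of (zip vs c) v of Some d \<Rightarrow> d | None \<Rightarrow> e v)"

text \<open>A formula in the variables \<open>vs\<close> with parameters from \<open>A\<close> is coded as a pair
  \<open>(\<psi>, e)\<close>, where the assignment \<open>e\<close> supplies the parameters for the free variables
  of \<open>\<psi>\<close> not in \<open>vs\<close>.\<close>

definition formulas_over ::
    "('f, 'r) language \<Rightarrow> 'u set \<Rightarrow> nat list \<Rightarrow> (('f, 'r) fm \<times> (nat \<Rightarrow> 'u)) set" where
  "formulas_over L A vs = {(\<psi>, e). is_formula L \<psi> \<and> e ` (fv \<psi> - set vs) \<subseteq> A}"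

definition realizes ::
    "('f, 'r, 'u) struct \<Rightarrow> nat list \<Rightarrow> 'u list \<Rightarrow> (('f, 'r) fm \<times> (nat \<Rightarrow> 'u)) set \<Rightarrow> bool" where
  "realizes N vs c \<Gamma> \<longleftrightarrow> (\<forall>(\<psi>, e)\<in>\<Gamma>. sat N (assign e vs c) \<psi>)"

text \<open>Saturation over a countable model is \<open>\<aleph>\<^sub>1\<close>-saturation: every (possibly partial)
  type in finitely many variables over a countable set of parameters is realized.\<close>

definition saturated :: "('f, 'r) language \<Rightarrow> ('f, 'r, 'u) struct \<Rightarrow> bool" where
  "saturated L N \<longleftrightarrow>
     (\<forall>A vs \<Gamma>. A \<subseteq> universe N \<and> countable A \<and> distinct vs \<and> \<Gamma> \<subseteq> formulas_over L A vs \<and>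
        (\<forall>\<Delta>. finite \<Delta> \<and> \<Delta> \<subseteq> \<Gamma> \<longrightarrow> (\<exists>c\<in>tuples (length vs) N. realizes N vs c \<Delta>)) \<longrightarrow>
        (\<exists>c\<in>tuples (length vs) N. realizes N vs c \<Gamma>))"


section \<open>The formula \<open>\<phi>(x, y)\<close> and its types\<close>

text \<open>Throughout, \<open>xs\<close> and \<open>ys\<close> are the lists of variables forming the tuples \<open>x\<close>
  and \<open>y\<close>.  Value 0 means true and 1 means false.\<close>

definition val ::
    "('f, 'r, 'u) struct \<Rightarrow> ('f, 'r) fm \<Rightarrow> nat list \<Rightarrow> nat list \<Rightarrow> 'u list \<Rightarrow> 'u list \<Rightarrow> real" where
  "val M \<phi> xs ys a b =
     (if sat M (assign (\<lambda>_. undefined) (xs @ ys) (a @ b)) \<phi> then 0 else 1)"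

definition has_IP ::
    "'u itself \<Rightarrow> ('f, 'r) language \<Rightarrow> ('f, 'r) fm set \<Rightarrow> ('f, 'r) fm \<Rightarrow> nat list \<Rightarrow> nat list \<Rightarrow> bool"
  where
  "has_IP _ L T \<phi> xs ys \<longleftrightarrow>
     (\<exists>N :: ('f, 'r, 'u) struct. is_model L T N \<and>
        (\<forall>n::nat. \<exists>(a :: nat \<Rightarrow> 'u list) (b :: nat set \<Rightarrow> 'u list).
           (\<forall>i<n. a i \<in> tuples (length xs) N) \<and>
           (\<forall>I\<subseteq>{..<n}. b I \<in> tuples (length ys) N) \<and>
           (\<forall>i<n. \<forall>I\<subseteq>{..<n}. val N \<phi> xs ys (a i) (b I) = 0 \<longleftrightarrow> i \<in> I)))"

abbreviation NIP ::
    "'u itself \<Rightarrow> ('f, 'r) language \<Rightarrow> ('f, 'r) fm set \<Rightarrow> ('f, 'r) fm \<Rightarrow> nat list \<Rightarrow> nat list \<Rightarrow> bool"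
  where
  "NIP U L T \<phi> xs ys \<equiv> \<not> has_IP U L T \<phi> xs ys"

text \<open>In the two type spaces, elementary extensions are taken up to isomorphism, that is, as
  elementary embeddings \<open>h\<close> into structures \<open>N\<close>.  Thus a structure whose universe
  exhausts an infinite type \<open>'u\<close> still has all the extensions in \<open>'u\<close> needed to
  realize its types (the language being countable).\<close>

definition phi_types ::
    "('f, 'r) language \<Rightarrow> ('f, 'r) fm \<Rightarrow> nat list \<Rightarrow> nat list \<Rightarrow> ('f, 'r, 'u) struct \<Rightarrow>
     ('u list \<Rightarrow> real) set" where
  "phi_types L \<phi> xs ys M =
     {\<lambda>b\<in>tuples (length ys) M. val N \<phi> xs ys a (map h b) | (N :: ('f, 'r, 'u) struct) h a.
        elementary_embedding L h M N \<and> a \<in> tuples (length xs) N}"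

definition opp_types ::
    "('f, 'r) language \<Rightarrow> ('f, 'r) fm \<Rightarrow> nat list \<Rightarrow> nat list \<Rightarrow> ('f, 'r, 'u) struct \<Rightarrow>
     ('u list \<Rightarrow> real) set" where
  "opp_types L \<phi> xs ys M =
     {\<lambda>a\<in>tuples (length xs) M. val N \<phi> xs ys (map h a) b | (N :: ('f, 'r, 'u) struct) h b.
        elementary_embedding L h M N \<and> b \<in> tuples (length ys) N}"

text \<open>The weakest topology on \<open>opp_types L \<phi> xs ys M\<close> making all evaluations
  \<open>q \<mapsto> q a\<close> continuous is the subspace topology of the product topology.\<close>

definition opp_type_space ::
    "('f, 'r) language \<Rightarrow> ('f, 'r) fm \<Rightarrow> nat list \<Rightarrow> nat list \<Rightarrow> ('f, 'r, 'u) struct \<Rightarrow>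
     ('u list \<Rightarrow> real) topology" where
  "opp_type_space L \<phi> xs ys M =
     subtopology (product_topology (\<lambda>_. euclideanreal) (tuples (length xs) M))
       (opp_types L \<phi> xs ys M)"

lemma topspace_opp_type_space: "topspace (opp_type_space L \<phi> xs ys M) = opp_types L \<phi> xs ys M"
  by (auto simp: opp_type_space_def opp_types_def PiE_def)

definition finitely_satisfiable_in ::
    "('f, 'r) fm \<Rightarrow> nat list \<Rightarrow> nat list \<Rightarrow> ('f, 'r, 'u) struct \<Rightarrow> ('f, 'r, 'u) struct \<Rightarrow>
     ('u list \<Rightarrow> real) \<Rightarrow> bool" where
  "finitely_satisfiable_in \<phi> xs ys M Ms p \<longleftrightarrow>
     (\<forall>B. finite B \<and> B \<subseteq> tuples (length ys) Ms \<longrightarrow>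
        (\<exists>a\<in>tuples (length xs) M. \<forall>b\<in>B. p b = val Ms \<phi> xs ys a b))"

definition opp_type_of ::
    "('f, 'r) fm \<Rightarrow> nat list \<Rightarrow> nat list \<Rightarrow> ('f, 'r, 'u) struct \<Rightarrow> ('f, 'r, 'u) struct \<Rightarrow>
     'u list \<Rightarrow> 'u list \<Rightarrow> real" where
  "opp_type_of \<phi> xs ys M Ms b = (\<lambda>a\<in>tuples (length xs) M. val Ms \<phi> xs ys a b)"

text \<open>The value \<open>\<phi>(p, q)\<close>: the common value of \<open>p\<close> at the realizations of \<open>q\<close> in
  \<open>Ms\<close>.  It is well defined when \<open>p\<close> is finitely satisfiable in \<open>M\<close> and \<open>Ms\<close>
  is a saturated elementary extension of the countable structure \<open>M\<close>.\<close>

definition type_pair_val ::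
    "('f, 'r) fm \<Rightarrow> nat list \<Rightarrow> nat list \<Rightarrow> ('f, 'r, 'u) struct \<Rightarrow> ('f, 'r, 'u) struct \<Rightarrow>
     ('u list \<Rightarrow> real) \<Rightarrow> ('u list \<Rightarrow> real) \<Rightarrow> real" where
  "type_pair_val \<phi> xs ys M Ms p q =
     (THE r. \<exists>b\<in>tuples (length ys) Ms. opp_type_of \<phi> xs ys M Ms b = q \<and> p b = r)"


section \<open>DBSC functions and DBSC definability\<close>

definition lower_semicont :: "'a topology \<Rightarrow> ('a \<Rightarrow> real) \<Rightarrow> bool" where
  "lower_semicont X F \<longleftrightarrow> (\<forall>c. openin X {q \<in> topspace X. c < F q})"

definition upper_semicont :: "'a topology \<Rightarrow> ('a \<Rightarrow> real) \<Rightarrow> bool" where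
  "upper_semicont X F \<longleftrightarrow> (\<forall>c. openin X {q \<in> topspace X. F q < c})"

definition bounded_semicont :: "'a topology \<Rightarrow> ('a \<Rightarrow> real) \<Rightarrow> bool" where
  "bounded_semicont X F \<longleftrightarrow>
     bounded (F ` topspace X) \<and> (lower_semicont X F \<or> upper_semicont X F)"

definition DBSC :: "'a topology \<Rightarrow> ('a \<Rightarrow> real) \<Rightarrow> bool" where
  "DBSC X f \<longleftrightarrow>
     (\<exists>F1 F2. bounded_semicont X F1 \<and> bounded_semicont X F2 \<and>
        (\<forall>q\<in>topspace X. f q = F1 q - F2 q))"

text \<open>The function \<open>\<phi>(a\<^sub>n, y)\<close> on the type space is \<open>q \<mapsto> q a\<^sub>n\<close>.\<close>

definition DBSC_definable ::
    "('f, 'r) language \<Rightarrow> ('f, 'r) fm \<Rightarrow> nat list \<Rightarrow> nat list \<Rightarrow> ('f, 'r, 'u) struct \<Rightarrow>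
     ('f, 'r, 'u) struct \<Rightarrow> ('u list \<Rightarrow> real) \<Rightarrow> bool" where
  "DBSC_definable L \<phi> xs ys M Ms p \<longleftrightarrow>
     (\<exists>(a :: nat \<Rightarrow> 'u list) f.
        (\<forall>n. a n \<in> tuples (length xs) M) \<and>
        DBSC (opp_type_space L \<phi> xs ys M) f \<and>
        (\<forall>q\<in>opp_types L \<phi> xs ys M. (\<lambda>n. q (a n)) \<longlonglongrightarrow> f q) \<and>
        (\<forall>q\<in>opp_types L \<phi> xs ys M. type_pair_val \<phi> xs ys M Ms p q = f q))"

end

theory Submission
  imports Defs
begin

text \<open>
  The three conditions are proved equivalent in a cycle.

  NIP implies DBSC definability (\<open>NIP_imp_DBSC_definable\<close>).  A type \<open>p\<close> that is finitely
  satisfiable in \<open>M\<close> is the limit of \<open>\<phi>(a, y)\<close> along an ultrafilter \<open>U\<close> on the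
  tuples \<open>a\<close> of \<open>M\<close>.  Call a finite pattern of truth values generic if for
  \<open>U\<close>-almost all \<open>x\<^sub>1\<close>, for \<open>U\<close>-almost all \<open>x\<^sub>2\<close>, and so on, some
  \<open>b\<close> realizes it along \<open>x\<^sub>1, x\<^sub>2, \<dots>\<close>.  If the alternating pattern of length
  \<open>2 * m\<close> is generic, then so are all patterns of length \<open>m\<close>, since they are subpatterns
  of it; finitely many sets of \<open>U\<close> can be intersected, so some tuple of length \<open>m\<close>
  realizes all patterns at once, that is, it is shattered.  Under NIP long alternation is therefore
  generically impossible.  As \<open>M\<close> is countable, one can choose a sequence \<open>(a\<^sub>n)\<close> in
  \<open>M\<close> that meets all the countably many sets of \<open>U\<close> witnessing this
  (\<open>generic_sequence\<close>).  Along this sequence the value \<open>\<phi>(a\<^sub>n, b)\<close> changes at most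
  \<open>2 * m\<close> times, for every \<open>b\<close>, and it tends to \<open>p(b)\<close>: otherwise \<open>b\<close> would
  alternate too often between some of the \<open>a\<^sub>n\<close> and generic elements inserted between them.
  The sequence plays the part of a Morley sequence, and its convergence that of the theorem of
  Bourgain, Fremlin and Talagrand.  A pointwise limit of continuous functions with uniformly bounded
  variation is a difference of two bounded lower semicontinuous functions
  (\<open>DBSC_bounded_variation\<close>), and saturation realizes every point of the type space
  (\<open>opp_type_realized\<close>).

  DBSC definability implies that there are few types (\<open>DBSC_definable_few\<close>): a definable type is
  determined by a sequence in the countable structure \<open>M\<close>, which leaves only
  \<open>2\<^bsup>\<aleph>\<^sub>0\<^esup>\<close> possibilities.

  The independence property implies that there are many types (\<open>IP_imp_many\<close>).  A countable model
  contains shattered sets of all finite sizes, and its ultrapower along a nonprincipal ultrafilter on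
  the natural numbers is saturated and contains a sequence \<open>(\<alpha>\<^sub>i)\<close> all of whose subsets are
  cut out by instances of \<open>\<phi>\<close>.  Every ultrafilter \<open>V\<close> on the natural numbers gives the
  limit along \<open>V\<close> of the types of the \<open>\<alpha>\<^sub>i\<close>.  These limits are finitely satisfiable in any
  countable elementary substructure containing the sequence, they are distinct for distinct
  ultrafilters, and by Pospisil's theorem there are \<open>2\<^bsup>2\<^bsup>\<aleph>\<^sub>0\<^esup>\<^esup>\<close> of them.
  All the structures constructed here have at most continuum many elements, so that they fit into the given
  type.
\<close>

section \<open>Ultrafilters\<close>

definition ultra :: "'a filter \<Rightarrow> bool" where
  "ultra U \<longleftrightarrow> U \<noteq> bot \<and> (\<forall>P. eventually P U \<or> eventually (\<lambda>x. \<not> P x) U)"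

lemma ultra_not:
  assumes "ultra U" shows "eventually (\<lambda>x. \<not> P x) U \<longleftrightarrow> \<not> eventually P U"
proof -
  have "\<not> (eventually P U \<and> eventually (\<lambda>x. \<not> P x) U)"
  proof
    assume "eventually P U \<and> eventually (\<lambda>x. \<not> P x) U"
    then have "eventually (\<lambda>x. P x \<and> \<not> P x) U" by (simp only: eventually_conj)
    then show False using assms by (simp add: ultra_def)
  qed
  moreover have "eventually P U \<or> eventually (\<lambda>x. \<not> P x) U" using assms unfolding ultra_def by blast
  ultimately show ?thesis by blast
qed

lemma ultra_imp:
  assumes "ultra U"
  shows "eventually (\<lambda>x. P x \<longrightarrow> Q x) U \<longleftrightarrow> (eventually P U \<longrightarrow> eventually Q U)"
proof (cases "eventually P U")
  case True
  then show ?thesis using eventually_mp[of P Q U] by (auto elim: eventually_mono)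
next
  case False
  then have "eventually (\<lambda>x. \<not> P x) U" by (simp add: ultra_not[OF assms])
  then have "eventually (\<lambda>x. P x \<longrightarrow> Q x) U" by (rule eventually_mono) simp
  then show ?thesis using False by simp
qed

lemma ultra_ex:
  assumes "ultra U" "eventually P U" shows "\<exists>x. P x"
  using assms eventually_happens[of P U] by (auto simp: ultra_def)

text \<open>By Zorn's lemma the family extends to a maximal one with the finite intersection property;
  maximality decides every predicate.\<close>

lemma FIP_ultrafilter:
  fixes S :: "'a set set"
  assumes fip: "\<And>D. finite D \<Longrightarrow> D \<subseteq> S \<Longrightarrow> \<Inter>D \<noteq> {}"
  obtains U where "ultra U" "\<And>X. X \<in> S \<Longrightarrow> eventually (\<lambda>x. x \<in> X) U"
proof -
  define C where "C = {T. S \<subseteq> T \<and> (\<forall>D. finite D \<longrightarrow> D \<subseteq> T \<longrightarrow> \<Inter>D \<noteq> {})}"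
  have "\<exists>M\<in>C. \<forall>X\<in>C. M \<subseteq> X \<longrightarrow> X = M"
  proof (rule subset_Zorn_nonempty)
    show "C \<noteq> {}" using fip by (auto simp: C_def)
    fix \<C> assume "\<C> \<noteq> {}" and ch: "subset.chain C \<C>"
    have "S \<subseteq> \<Union>\<C>"
    proof -
      obtain T where "T \<in> \<C>" using \<open>\<C> \<noteq> {}\<close> by blast
      then have "S \<subseteq> T" using ch by (auto simp: C_def subset_chain_def)
      then show ?thesis using \<open>T \<in> \<C>\<close> by blast
    qed
    moreover have "\<Inter>D \<noteq> {}" if D: "finite D" "D \<subseteq> \<Union>\<C>" for D
    proof -
      obtain T where "T \<in> \<C>" "D \<subseteq> T"
        using finite_subset_Union_chain[OF D \<open>\<C> \<noteq> {}\<close> ch] by blast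
      then show ?thesis using ch D(1) by (auto simp: C_def subset_chain_def)
    qed
    ultimately show "\<Union>\<C> \<in> C" by (auto simp: C_def)
  qed
  then obtain M where M: "M \<in> C" and mx: "\<And>X. X \<in> C \<Longrightarrow> M \<subseteq> X \<Longrightarrow> X = M" by blast
  define U where "U = (INF X\<in>M. principal X)"
  have ev: "eventually (\<lambda>x. x \<in> X) U" if "X \<in> M" for X
    unfolding U_def by (rule eventually_INF1[OF that]) (simp add: eventually_principal)
  have fin: "eventually P U" if "finite D" "D \<subseteq> M" "\<And>x. x \<in> \<Inter>D \<Longrightarrow> P x" for P D
  proof -
    have "eventually (\<lambda>x. \<forall>X\<in>D. x \<in> X) U"
      using that(1,2) ev by (auto intro!: eventually_ball_finite)
    then show ?thesis by (rule eventually_mono) (auto intro: that(3))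
  qed
  have "U \<noteq> bot"
    unfolding U_def
  proof (rule INF_filter_not_bot)
    fix D assume "D \<subseteq> M" "finite D"
    then have "\<Inter>D \<noteq> {}" using M by (auto simp: C_def)
    then show "(INF X\<in>D. principal X) \<noteq> bot"
      using INF_principal_finite[OF \<open>finite D\<close>, of "\<lambda>X. X"] by (simp add: principal_eq_bot_iff)
  qed
  moreover have "eventually P U \<or> eventually (\<lambda>x. \<not> P x) U" for P
  proof (cases "insert {x. P x} M \<in> C")
    case True
    then have "{x. P x} \<in> M" using mx[OF True] by blast
    then show ?thesis using ev by fastforce
  next
    case False
    then obtain D where D: "finite D" "D \<subseteq> insert {x. P x} M" "\<Inter>D = {}"
      using M by (auto simp: C_def)
    then have "eventually (\<lambda>x. \<not> P x) U"
      using fin[of "D - {{x. P x}}" "\<lambda>x. \<not> P x"] by auto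
    then show ?thesis ..
  qed
  ultimately have "ultra U" by (simp add: ultra_def)
  moreover have "S \<subseteq> M" using M by (simp add: C_def)
  ultimately show ?thesis using ev that by blast
qed

lemma nonprincipal_ultrafilter:
  obtains U :: "nat filter" where "ultra U" "U \<le> sequentially"
proof -
  obtain U :: "nat filter" where U: "ultra U" "\<And>X. X \<in> range (\<lambda>k::nat. {k..}) \<Longrightarrow> eventually (\<lambda>x. x \<in> X) U"
  proof (rule FIP_ultrafilter)
    fix D :: "nat set set" assume D: "finite D" "D \<subseteq> range (\<lambda>k. {k..})"
    then obtain K where K: "finite K" "D = (\<lambda>k. {k..}) ` K"
      by (meson finite_subset_image)
    then have "Max (insert 0 K) \<in> \<Inter>D" by auto
    then show "\<Inter>D \<noteq> {}" by blast
  qed blast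
  have "U \<le> sequentially"
    unfolding at_top_def le_INF_iff  proof
    fix k :: nat
    show "U \<le> principal {k..}" using U(2)[of "{k..}"] by (simp add: le_principal)
  qed
  with U(1) that show ?thesis by blast
qed

text \<open>The natural numbers code the pairs of a finite set \<open>s\<close> and a finite family of subsets of
  \<open>s\<close> (both given by lists).  A set \<open>X\<close> passes the test \<open>(s, T)\<close> if its trace
  on \<open>s\<close> is in the family \<open>T\<close>.\<close>

definition trace_test :: "nat set \<Rightarrow> nat set" where
  "trace_test X = {n. case from_nat n of (s, T) \<Rightarrow> X \<inter> set s \<in> set ` set (T :: nat list list)}"

text \<open>Finitely many distinct sets have distinct traces on some finite \<open>s\<close>; the test that
  accepts exactly the traces of the members of \<open>P\<close> then separates \<open>P\<close> from \<open>N\<close>.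
  Thus \<open>trace_test\<close> is an independent family of continuum many sets of natural numbers.\<close>

lemma trace_test_independent:
  assumes "finite P" "finite N" "P \<inter> N = {}"
  shows "(\<Inter>X\<in>P. trace_test X) \<inter> (\<Inter>X\<in>N. - trace_test X) \<noteq> {}"
proof -
  define d where "d = (\<lambda>(X, Y). SOME z::nat. (z \<in> X) \<noteq> (z \<in> Y))"
  define s where "s = d ` (P \<times> N)"
  have "finite s" using assms by (simp add: s_def)
  then obtain sl where sl: "set sl = s" using finite_list by blast
  have sep: "X \<inter> s \<noteq> Y \<inter> s" if "X \<in> P" "Y \<in> N" for X Y
  proof -
    have "X \<noteq> Y" using that assms by blast
    then have "\<exists>z. (z \<in> X) \<noteq> (z \<in> Y)" by blast
    then have "(d (X,Y) \<in> X) \<noteq> (d (X,Y) \<in> Y)" unfolding d_def by (simp only: prod.case) (rule someI_ex)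
    moreover have "d (X,Y) \<in> s" using that by (auto simp: s_def)
    ultimately show ?thesis by blast
  qed
  have "\<exists>T. set T = (\<lambda>X. sorted_list_of_set (X \<inter> s)) ` P"
    by (rule finite_list) (simp add: assms(1))
  then obtain T where T: "set T = (\<lambda>X. sorted_list_of_set (X \<inter> s)) ` P" ..
  have "set ` set T = (\<lambda>X. X \<inter> s) ` P"
    using \<open>finite s\<close> by (simp add: T image_image)
  then have "to_nat (sl, T) \<in> (\<Inter>X\<in>P. trace_test X) \<inter> (\<Inter>X\<in>N. - trace_test X)"
    by (auto simp: trace_test_def sl) (metis sep)
  then show ?thesis by blast
qed

text \<open>Pospisil's theorem that there are \<open>2\<^bsup>2\<^bsup>\<aleph>\<^sub>0\<^esup>\<^esup>\<close> ultrafilters on the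
  natural numbers: each subset of the continuum can be prescribed as the set of members of the
  independent family that belong to the ultrafilter.\<close>

lemma many_ultrafilters:
  obtains V :: "nat set set \<Rightarrow> nat filter"
  where "\<And>W. ultra (V W)" "\<And>W X. eventually (\<lambda>n. n \<in> trace_test X) (V W) \<longleftrightarrow> X \<in> W"
proof -
  have "\<exists>U. ultra U \<and> (\<forall>X. eventually (\<lambda>n. n \<in> trace_test X) U \<longleftrightarrow> X \<in> W)" for W
  proof -
    define S where "S = trace_test ` W \<union> (\<lambda>X. - trace_test X) ` (- W)"
    obtain U where U: "ultra U" "\<And>X. X \<in> S \<Longrightarrow> eventually (\<lambda>x. x \<in> X) U"
    proof (rule FIP_ultrafilter)
      fix D assume D: "finite D" "D \<subseteq> S"
      have "finite (D \<inter> trace_test ` W)" "finite (D \<inter> (\<lambda>X. - trace_test X) ` (- W))" using D by auto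
      then obtain P N where PN: "finite P" "P \<subseteq> W" "D \<inter> trace_test ` W = trace_test ` P"
         "finite N" "N \<subseteq> - W" "D \<inter> (\<lambda>X. - trace_test X) ` (- W) = (\<lambda>X. - trace_test X) ` N"
        by (meson finite_subset_image inf_le2)
      have "(\<Inter>X\<in>P. trace_test X) \<inter> (\<Inter>X\<in>N. - trace_test X) \<noteq> {}"
      proof (rule trace_test_independent[OF PN(1,4)])
        show "P \<inter> N = {}" using PN(2,5) by blast
      qed
      moreover have "\<Inter>D = (\<Inter>X\<in>P. trace_test X) \<inter> (\<Inter>X\<in>N. - trace_test X)"
      proof -
        have "D = (D \<inter> trace_test ` W) \<union> (D \<inter> (\<lambda>X. - trace_test X) ` (- W))"
          using D(2) unfolding S_def by blast
        also have "\<dots> = trace_test ` P \<union> (\<lambda>X. - trace_test X) ` N" by (simp only: PN(3,6))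
        finally have "\<Inter>D = \<Inter>(trace_test ` P \<union> (\<lambda>X. - trace_test X) ` N)" by (rule arg_cong)
        then show ?thesis by (simp only: Inter_Un_distrib)
      qed
      ultimately show "\<Inter>D \<noteq> {}" by (simp only: not_False_eq_True)
    qed blast
    have "eventually (\<lambda>n. n \<in> trace_test X) U" if "X \<in> W" for X using U(2) that by (auto simp: S_def)
    moreover have "\<not> eventually (\<lambda>n. n \<in> trace_test X) U" if "X \<notin> W" for X
      using U(2)[of "- trace_test X"] that ultra_not[OF U(1), of "\<lambda>n. n \<in> trace_test X"] by (auto simp: S_def)
    ultimately show ?thesis using U(1) by blast
  qed
  then show ?thesis using that by metis
qed

section \<open>Generic sequences for relations of bounded shattering\<close>

text \<open>\<open>generic_pattern U R [t\<^sub>1, \<dots>, t\<^sub>k] S\<close> says: for \<open>U\<close>-almost all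
  \<open>x\<^sub>1\<close>, for \<open>U\<close>-almost all \<open>x\<^sub>2\<close>, and so on up to \<open>x\<^sub>k\<close>, some
  \<open>b \<in> S\<close> has the truth values \<open>t\<^sub>1, \<dots>, t\<^sub>k\<close> at \<open>x\<^sub>1, \<dots>, x\<^sub>k\<close>.
  The recursion keeps in \<open>S\<close> those \<open>b\<close> that agree with the pattern so far.\<close>

fun generic_pattern :: "'a filter \<Rightarrow> ('a \<Rightarrow> 'b \<Rightarrow> bool) \<Rightarrow> bool list \<Rightarrow> 'b set \<Rightarrow> bool" where
  "generic_pattern U R [] S \<longleftrightarrow> S \<noteq> {}"
| "generic_pattern U R (t # \<eta>) S \<longleftrightarrow> eventually (\<lambda>x. generic_pattern U R \<eta> {b\<in>S. R x b = t}) U"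

fun alternating :: "bool \<Rightarrow> nat \<Rightarrow> bool list" where
  "alternating t 0 = []"
| "alternating t (Suc k) = t # alternating (\<not> t) k"

lemma generic_pattern_mono: "generic_pattern U R \<eta> S \<Longrightarrow> S \<subseteq> S' \<Longrightarrow> generic_pattern U R \<eta> S'"
proof (induction \<eta> arbitrary: S S')
  case (Cons t \<eta>)
  show ?case using Cons.prems(1) unfolding generic_pattern.simps
    by (rule eventually_mono) (erule Cons.IH, use Cons.prems(2) in auto)
qed auto

lemma generic_pattern_drop: "ultra U \<Longrightarrow> generic_pattern U R (t # \<eta>) S \<Longrightarrow> generic_pattern U R \<eta> S"
  by (auto dest!: ultra_ex elim: generic_pattern_mono)

text \<open>Two consecutive entries of an alternating pattern contain both truth values.  So every
  pattern is obtained from an alternating one of twice the length by dropping one entry of each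
  pair, and an entry may be dropped because its variable becomes a dummy.\<close>

lemma generic_pattern_of_alternating:
  assumes U: "ultra U"
  shows "generic_pattern U R (alternating t (2 * length \<eta>)) S \<Longrightarrow> generic_pattern U R \<eta> S"
proof (induction \<eta> arbitrary: S)
  case (Cons s \<eta>)
  let ?z = "alternating t (2 * length \<eta>)"
  have *: "generic_pattern U R (t # (\<not> t) # ?z) S" using Cons.prems by simp
  have "generic_pattern U R (s # ?z) S"
  proof (cases "s = t")
    case True
    have "eventually (\<lambda>x. generic_pattern U R ((\<not> t) # ?z) {b\<in>S. R x b = t}) U" using * by simp
    then show ?thesis unfolding generic_pattern.simps True
      by (rule eventually_mono) (rule generic_pattern_drop[OF U, of R "\<not> t"], simp)
  next
    case False
    then show ?thesis using generic_pattern_drop[OF U *] by (cases s; cases t; simp)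
  qed
  then show ?case unfolding generic_pattern.simps by (rule eventually_mono) (rule Cons.IH)
qed (use generic_pattern_drop U in auto)

text \<open>Finitely many patterns of the same length can be handled with the same \<open>x\<^sub>1, x\<^sub>2, \<dots>\<close>,
  since an ultrafilter is closed under finite intersections.  In \<open>not_generic_alternating\<close> below the
  index set consists of all patterns of length \<open>m\<close>, so that the common tuple is shattered.\<close>

lemma generic_patterns_common_tuple:
  assumes U: "ultra U" and A: "eventually (\<lambda>x. x \<in> A) U" and J: "finite J"
  shows "(\<forall>j\<in>J. length (h j) = m \<and> generic_pattern U R (h j) (S j)) \<Longrightarrow>
    \<exists>as. length as = m \<and> set as \<subseteq> A \<and> (\<forall>j\<in>J. \<exists>b\<in>S j. \<forall>i<m. R (as ! i) b = h j ! i)"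
proof (induction m arbitrary: h S)
  case 0
  then show ?case by (auto simp: ex_in_conv)
next
  case (Suc m)
  have "eventually (\<lambda>x. \<forall>j\<in>J. generic_pattern U R (tl (h j)) {b\<in>S j. R x b = hd (h j)}) U"
  proof (rule eventually_ball_finite[OF J], rule ballI)
    fix j assume "j \<in> J"
    then show "eventually (\<lambda>x. generic_pattern U R (tl (h j)) {b\<in>S j. R x b = hd (h j)}) U"
      using Suc.prems by (cases "h j") auto
  qed
  then obtain x where x: "x \<in> A" "\<forall>j\<in>J. generic_pattern U R (tl (h j)) {b\<in>S j. R x b = hd (h j)}"
    using ultra_ex[OF U eventually_conj[OF A]] by blast
  have "\<forall>j\<in>J. length (tl (h j)) = m \<and> generic_pattern U R (tl (h j)) {b\<in>S j. R x b = hd (h j)}"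
    using x Suc.prems by simp
  from Suc.IH[OF this] obtain as where as: "length as = m" "set as \<subseteq> A"
     "\<forall>j\<in>J. \<exists>b\<in>{b\<in>S j. R x b = hd (h j)}. \<forall>i<m. R (as ! i) b = tl (h j) ! i" by auto
  have "\<forall>j\<in>J. \<exists>b\<in>S j. \<forall>i<Suc m. R ((x # as) ! i) b = h j ! i"
  proof
    fix j assume j: "j \<in> J"
    then obtain b where b: "b \<in> S j" "R x b = hd (h j)" "\<forall>i<m. R (as ! i) b = tl (h j) ! i" using as by blast
    have "R ((x # as) ! i) b = h j ! i" if "i < Suc m" for i
      using that b Suc.prems j by (cases i; cases "h j") auto
    then show "\<exists>b\<in>S j. \<forall>i<Suc m. R ((x # as) ! i) b = h j ! i" using b by blast
  qed
  then show ?case using as x by (intro exI[of _ "x # as"]) auto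
qed

definition shatters :: "('a \<Rightarrow> 'b \<Rightarrow> bool) \<Rightarrow> 'b set \<Rightarrow> 'a list \<Rightarrow> bool" where
  "shatters R B as \<longleftrightarrow> (\<forall>I. \<exists>b\<in>B. \<forall>i<length as. R (as ! i) b \<longleftrightarrow> i \<in> I)"

lemma not_generic_alternating:
  assumes U: "ultra U" and A: "eventually (\<lambda>x. x \<in> A) U"
    and no: "\<And>as. set as \<subseteq> A \<Longrightarrow> length as = m \<Longrightarrow> \<not> shatters R B as"
  shows "\<not> generic_pattern U R (alternating t (2 * m)) B"
proof
  assume *: "generic_pattern U R (alternating t (2 * m)) B"
  define J where "J = {\<eta> :: bool list. length \<eta> = m}"
  have J: "finite J" unfolding J_def using finite_lists_length_eq[of "UNIV :: bool set" m] by simp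
  have "\<forall>\<eta>\<in>J. length (id \<eta>) = m \<and> generic_pattern U R (id \<eta>) B"
    using * generic_pattern_of_alternating[OF U] by (auto simp: J_def)
  from generic_patterns_common_tuple[OF U A J this] obtain as where
    as: "length as = m" "set as \<subseteq> A" "\<forall>\<eta>\<in>J. \<exists>b\<in>B. \<forall>i<m. R (as ! i) b = \<eta> ! i" by auto
  have "shatters R B as" unfolding shatters_def
  proof
    fix I
    have "map (\<lambda>i. i \<in> I) [0..<m] \<in> J" by (simp add: J_def)
    then obtain b where "b \<in> B" "\<forall>i<m. R (as ! i) b = (i \<in> I)" using as(3) by fastforce
    then show "\<exists>b\<in>B. \<forall>i<length as. R (as ! i) b \<longleftrightarrow> i \<in> I" using as(1) by blast
  qed
  then show False using no as by blast
qed

text \<open>Put \<open>k = 2 * m\<close>.  A tuple \<open>c\<close> is called valid if, with \<open>c\<close> as its first entries,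
  the alternating pattern of length \<open>k\<close> remains generically unrealized.  The empty tuple is
  valid, and \<open>U\<close>-almost every \<open>x\<close> extends a valid tuple to a valid one.  No \<open>b \<in> B\<close>
  alternates along a valid tuple of length \<open>k\<close>.

  The set \<open>A\<close> being countable, there are only countably many tuples, so a sequence
  \<open>a\<close> can be chosen in which every late member extends any given valid tuple, and in which
  \<open>a n\<close> moreover extends the short valid tuples built from its predecessors.  The second
  property bounds the number of changes of \<open>R (a n) b\<close>.  The first gives the limit: if
  \<open>R (a n) b\<close> differed infinitely often from the \<open>U\<close>-limit, then both truth values would be
  available for extending any valid tuple, one among the \<open>a n\<close> and the other
  \<open>U\<close>-almost everywhere, and \<open>b\<close> would alternate along a valid tuple of length \<open>k\<close>.\<close>

lemma generic_sequence:
  fixes R :: "'a \<Rightarrow> 'b \<Rightarrow> bool"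
  assumes U: "ultra U" and A: "eventually (\<lambda>x. x \<in> A) U" and cA: "countable A"
    and no: "\<And>as. set as \<subseteq> A \<Longrightarrow> length as = m \<Longrightarrow> \<not> shatters R B as"
  obtains a :: "nat \<Rightarrow> 'a" where "\<And>n. a n \<in> A"
    "\<And>b. b \<in> B \<Longrightarrow> eventually (\<lambda>n. R (a n) b \<longleftrightarrow> eventually (\<lambda>x. R x b) U) sequentially"
    "\<And>b N. b \<in> B \<Longrightarrow> card {n. n < N \<and> R (a (Suc n)) b \<noteq> R (a n) b} \<le> 2 * m"
proof -
  define k where "k = 2 * m"
  define Sc where "Sc c = {b\<in>B. \<forall>i<length c. R (c ! i) b = even i}" for c
  define rest where "rest c = alternating (even (length c)) (k - length c)" for c :: "'a list"
  define valid where "valid c \<longleftrightarrow> set c \<subseteq> A \<and> length c \<le> k \<and> \<not> generic_pattern U R (rest c) (Sc c)" for c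
  define G where "G c = {x\<in>A. valid c \<longrightarrow> length c < k \<longrightarrow> valid (c @ [x])}" for c
  have Sc_app: "Sc (c @ [x]) = {b \<in> Sc c. R x b = even (length c)}" for c x
    unfolding Sc_def by (auto simp: nth_append less_Suc_eq)
  have v0: "valid []"
    using not_generic_alternating[OF U A no] by (simp add: valid_def rest_def Sc_def k_def)
  have lt: "length c < k" if "valid c" "b \<in> Sc c" for c b
  proof (rule ccontr)
    assume "\<not> length c < k"
    then have "length c = k" using that by (simp add: valid_def)
    then show False using that by (auto simp: valid_def rest_def)
  qed
  have G: "eventually (\<lambda>x. x \<in> G c) U" for c
  proof (cases "valid c \<and> length c < k")
    case True
    then have r: "rest c = even (length c) # alternating (odd (length c)) (k - Suc (length c))"
      unfolding rest_def by (metis Suc_diff_Suc alternating.simps(2))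
    have "\<not> generic_pattern U R (even (length c) # alternating (odd (length c)) (k - Suc (length c))) (Sc c)"
      using True r by (simp add: valid_def)
    then have "eventually (\<lambda>x. \<not> generic_pattern U R (alternating (odd (length c)) (k - Suc (length c))) (Sc (c @ [x]))) U"
      unfolding generic_pattern.simps ultra_not[OF U, symmetric] Sc_app .
    with A show ?thesis
      by eventually_elim (use True in \<open>auto simp: G_def valid_def rest_def\<close>)
  next
    case False
    show ?thesis using A by eventually_elim (use False in \<open>auto simp: G_def\<close>)
  qed
  define pick where "pick H = (SOME x. x \<in> A \<and> (\<forall>c\<in>H. x \<in> G c))" for H
  have pick: "pick H \<in> A \<and> (\<forall>c\<in>H. pick H \<in> G c)" if "finite H" for H
  proof -
    have "eventually (\<lambda>x. x \<in> A \<and> (\<forall>c\<in>H. x \<in> G c)) U"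
      using that G A by (auto intro!: eventually_conj eventually_ball_finite)
    then show ?thesis unfolding pick_def by (rule someI_ex[OF ultra_ex[OF U]])
  qed
  have cl: "countable (lists A)" using cA by simp
  define cs where "cs = from_nat_into (lists A)"
  \<comment> \<open>The initial segment of the enumeration serves for the limit, the tuples of
    predecessors for the bound on the number of changes.\<close>
  define H where "H l = cs ` {..length l} \<union> {c. set c \<subseteq> set l \<and> length c \<le> k}" for l
  have finH: "finite (H l)" for l unfolding H_def by (simp add: finite_lists_length_le)
  define pre where "pre = rec_nat [] (\<lambda>_ l. l @ [pick (H l)])"
  define a where "a n = pick (H (pre n))" for n
  have pre0: "pre 0 = []" and preS: "pre (Suc n) = pre n @ [a n]" for n
    by (simp_all add: pre_def a_def)
  have pre: "pre n = map a [0..<n]" for n by (induction n) (simp_all add: pre0 preS)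
  have an: "a n = pick (H (map a [0..<n]))" for n
    using a_def[of n] unfolding pre .
  have aH: "a n \<in> A" "c \<in> H (map a [0..<n]) \<Longrightarrow> a n \<in> G c" for n c
    using pick[OF finH, of "map a [0..<n]"] unfolding an[symmetric] by blast+
  note aA = aH(1)
  have aG1: "a n \<in> G (cs i)" if "i \<le> n" for i n
    by (rule aH(2)) (use that in \<open>auto simp: H_def\<close>)
  have aG2: "a n \<in> G c" if "set c \<subseteq> a ` {..<n}" "length c \<le> k" for c n
    by (rule aH(2)) (use that in \<open>auto simp: H_def atLeast0LessThan\<close>)
  have lim: "eventually (\<lambda>n. R (a n) b \<longleftrightarrow> eventually (\<lambda>x. R x b) U) sequentially" if b: "b \<in> B" for b
  proof (rule ccontr)
    assume neg: "\<not> ?thesis"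
    let ?l = "eventually (\<lambda>x. R x b) U"
    have ext: "\<exists>x. x \<in> G c \<and> R x b = t" if c: "valid c" for c t
    proof (cases "t = ?l")
      case True
      have "eventually (\<lambda>x. R x b = ?l) U" using ultra_not[OF U, of "\<lambda>x. R x b"] by (cases ?l) auto
      then have "eventually (\<lambda>x. x \<in> G c \<and> R x b = ?l) U" using G eventually_conj by blast
      then show ?thesis using ultra_ex[OF U] True by blast
    next
      case False
      have "c \<in> lists A" using c by (auto simp: valid_def)
      then obtain i where i: "cs i = c"
        unfolding cs_def using from_nat_into_surj[OF cl] by blast
      have "\<exists>n\<ge>i. R (a n) b \<noteq> ?l" using neg by (auto simp: eventually_sequentially)
      then show ?thesis using aG1[of i] i False by (metis (full_types))
    qed
    have "\<exists>c. valid c \<and> b \<in> Sc c \<and> length c = l" if "l \<le> k" for l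
      using that
    proof (induction l)
      case 0
      show ?case using v0 b by (intro exI[of _ "[]"]) (auto simp: Sc_def)
    next
      case (Suc l)
      then obtain c where c: "valid c" "b \<in> Sc c" "length c = l" by auto
      obtain x where "x \<in> G c" "R x b = even l" using ext[OF c(1)] by blast
      then have "valid (c @ [x])" "b \<in> Sc (c @ [x])" using c Suc.prems by (auto simp: G_def Sc_app)
      then show ?case using c by (intro exI[of _ "c @ [x]"]) auto
    qed
    then show False using lt by blast
  qed
  have var: "card {n. n < N \<and> R (a (Suc n)) b \<noteq> R (a n) b} \<le> 2 * m" if b: "b \<in> B" for b N
  proof -
    have step: "valid (c @ [a n]) \<and> b \<in> Sc (c @ [a n])"
      if "valid c" "b \<in> Sc c" "set c \<subseteq> a ` {..<n}" "R (a n) b = even (length c)" for c n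
      using lt[OF that(1,2)] aG2[OF that(3)] that by (auto simp: G_def Sc_app)
    \<comment> \<open>The tuple records the members at which the value has changed, beginning with the first
      true value; the parity of its length therefore gives the current value.\<close>
    have "\<exists>c. valid c \<and> b \<in> Sc c \<and> set c \<subseteq> a ` {..<Suc N} \<and> R (a N) b = odd (length c) \<and>
       card {n. n < N \<and> R (a (Suc n)) b \<noteq> R (a n) b} \<le> length c"
    proof (induction N)
      case 0
      have b0: "b \<in> Sc []" using b by (simp add: Sc_def)
      show ?case
      proof (cases "R (a 0) b")
        case True
        then show ?thesis using step[OF v0 b0, of 0] by (intro exI[of _ "[a 0]"]) simp
      next
        case False
        then show ?thesis using v0 b0 by (intro exI[of _ "[]"]) simp
      qed
    next
      case (Suc N)
      then obtain c where c: "valid c" "b \<in> Sc c" "set c \<subseteq> a ` {..<Suc N}" "R (a N) b = odd (length c)"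
         "card {n. n < N \<and> R (a (Suc n)) b \<noteq> R (a n) b} \<le> length c" by blast
      show ?case
      proof (cases "R (a (Suc N)) b = R (a N) b")
        case True
        then have "{n. n < Suc N \<and> R (a (Suc n)) b \<noteq> R (a n) b} = {n. n < N \<and> R (a (Suc n)) b \<noteq> R (a n) b}"
          by (auto simp: less_Suc_eq)
        then show ?thesis using c True by (intro exI[of _ c]) auto
      next
        case False
        then have "{n. n < Suc N \<and> R (a (Suc n)) b \<noteq> R (a n) b} = insert N {n. n < N \<and> R (a (Suc n)) b \<noteq> R (a n) b}"
          by (auto simp: less_Suc_eq)
        then have "card {n. n < Suc N \<and> R (a (Suc n)) b \<noteq> R (a n) b} \<le> length (c @ [a (Suc N)])"
          using c(5) by simp
        moreover have "R (a (Suc N)) b = even (length c)" using False c(4) by auto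
        ultimately show ?thesis using step[OF c(1-3)] c(3)
          by (intro exI[of _ "c @ [a (Suc N)]"]) auto
      qed
    qed
    then obtain c where "valid c" "card {n. n < N \<and> R (a (Suc n)) b \<noteq> R (a n) b} \<le> length c" by blast
    then show ?thesis by (auto simp: valid_def k_def)
  qed
  show ?thesis by (rule that[OF aA lim var])
qed

section \<open>Formulas and assignments\<close>

lemma tval_cong: "(\<And>v. v \<in> tvars t \<Longrightarrow> e v = e' v) \<Longrightarrow> tval M e t = tval M e' t"
proof (induction t)
  case (Fun g ts)
  then have "map (tval M e) ts = map (tval M e') ts" by auto
  then show ?case by (simp only: tval.simps)
qed simp

lemma sat_cong: "(\<And>v. v \<in> fv \<psi> \<Longrightarrow> e v = e' v) \<Longrightarrow> sat M e \<psi> = sat M e' \<psi>"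
proof (induction \<psi> arbitrary: e e')
  case (Equal s t)
  then show ?case using tval_cong[of s e e' M] tval_cong[of t e e' M] by simp
next
  case (Rel R ts)
  then have "map (tval M e) ts = map (tval M e') ts" by (auto intro!: tval_cong)
  then show ?case by (simp only: sat.simps)
next
  case (Imp \<psi> \<theta>)
  have "sat M e \<psi> = sat M e' \<psi>" "sat M e \<theta> = sat M e' \<theta>"
    by (rule Imp.IH, simp add: Imp.prems)+
  then show ?case by simp
next
  case (All v \<psi>)
  have "sat M (e(v := d)) \<psi> = sat M (e'(v := d)) \<psi>" for d
    by (rule All.IH) (use All.prems in auto)
  then show ?case by simp
qed simp

lemma finite_tvars: "finite (tvars t)"
  by (induction t) auto

lemma finite_fv: "finite (fv \<psi>)"
  by (induction \<psi>) (auto simp: finite_tvars)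

text \<open>The symbols of a countable language may come from uncountable types.  Numbering them embeds
  the formulas of the language into the formulas over the natural numbers, a countable type.\<close>

instance trm :: (countable) countable by countable_datatype
instance fm :: (countable, countable) countable by countable_datatype

lemma is_term_set: "is_term L t \<Longrightarrow> set_trm t \<subseteq> Funs L"
  by (induction t) auto

lemma is_formula_set: "is_formula L \<psi> \<Longrightarrow> set1_fm \<psi> \<subseteq> Funs L \<and> set2_fm \<psi> \<subseteq> Rels L"
  by (induction \<psi>) (use is_term_set in fastforce)+

lemma countable_formulas:
  assumes "countable_language L"
  shows "countable {\<psi>. is_formula L \<psi>}"
proof (rule countableI')
  define m where "m = map_fm (to_nat_on (Funs L)) (to_nat_on (Rels L))"
  have c: "countable (Funs L)" "countable (Rels L)" using assms by (auto simp: countable_language_def)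
  have "inj_on m {\<psi>. is_formula L \<psi>}"
  proof (rule inj_onI)
    fix \<psi> \<theta> assume "\<psi> \<in> {\<psi>. is_formula L \<psi>}" "\<theta> \<in> {\<psi>. is_formula L \<psi>}" and eq: "m \<psi> = m \<theta>"
    then have s: "set1_fm \<psi> \<subseteq> Funs L" "set2_fm \<psi> \<subseteq> Rels L" "set1_fm \<theta> \<subseteq> Funs L" "set2_fm \<theta> \<subseteq> Rels L"
      using is_formula_set by blast+
    show "\<psi> = \<theta>"
    proof (rule fm.inj_map_strong[OF _ _ eq[unfolded m_def]])
      fix z za assume "z \<in> set1_fm \<psi>" "za \<in> set1_fm \<theta>" "to_nat_on (Funs L) z = to_nat_on (Funs L) za"
      then show "z = za" using s inj_on_to_nat_on[OF c(1)] by (auto dest: inj_onD)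
    next
      fix z za assume "z \<in> set2_fm \<psi>" "za \<in> set2_fm \<theta>" "to_nat_on (Rels L) z = to_nat_on (Rels L) za"
      then show "z = za" using s inj_on_to_nat_on[OF c(2)] by (auto dest: inj_onD)
    qed
  qed
  then show "inj_on (\<lambda>\<psi>. to_nat (m \<psi>)) {\<psi>. is_formula L \<psi>}"
    by (auto simp: inj_on_def)
qed

lemma assign_notin:
  assumes "v \<notin> set vs" shows "assign e vs c v = e v"
  using assms by (auto simp: assign_def split: option.split dest!: map_of_SomeD set_zip_leftD)

lemma assign_nth:
  assumes "distinct vs" "length c = length vs" "i < length vs"
  shows "assign e vs c (vs ! i) = c ! i"
  using assms map_of_zip_nth[of vs c i] by (simp add: assign_def)

lemma assign_in:
  assumes "length c = length vs" "v \<in> set vs"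
  shows "assign e vs c v \<in> set c" "assign e vs c v = assign e' vs c v"
proof -
  obtain d where d: "map_of (zip vs c) v = Some d"
    using assms by (metis map_of_zip_is_Some)
  then show "assign e vs c v \<in> set c"
    by (auto simp: assign_def dest!: map_of_SomeD set_zip_rightD)
  show "assign e vs c v = assign e' vs c v" using d by (simp add: assign_def)
qed

lemma assign_range:
  assumes "length c = length vs" "set c \<subseteq> X" "range e \<subseteq> X"
  shows "range (assign e vs c) \<subseteq> X"
proof
  fix d assume "d \<in> range (assign e vs c)"
  then obtain v where "d = assign e vs c v" by blast
  then show "d \<in> X" using assms assign_in(1)[of c vs v e] assign_notin[of v vs e c] by (cases "v \<in> set vs") auto
qed

lemma assign_map: "assign (\<lambda>v. h (e v)) vs (map h c) v = h (assign e vs c v)"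
proof -
  have "map_of (zip vs (map h c)) v = map_option h (map_of (zip vs c) v)"
    by (simp add: zip_map2 map_of_map)
  then show ?thesis by (simp add: assign_def split: option.split)
qed

lemma assign_append:
  assumes "length a = length xs"
  shows "assign e (xs @ ys) (a @ b) = assign (assign e ys b) xs a"
  using assms by (auto simp: assign_def fun_eq_iff map_add_def split: option.splits
      dest!: map_of_SomeD set_zip_leftD)

lemma sat_assign_irrelevant:
  assumes "fv \<phi> \<subseteq> set vs" "length c = length vs"
  shows "sat M (assign e vs c) \<phi> = sat M (assign e' vs c) \<phi>"
  by (rule sat_cong) (use assms assign_in(2) in blast)

section \<open>Elementary embeddings\<close>

definition Neg :: "('f, 'r) fm \<Rightarrow> ('f, 'r) fm" where "Neg \<psi> = Imp \<psi> Falsum"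
definition Conj :: "('f, 'r) fm list \<Rightarrow> ('f, 'r) fm" where "Conj \<psi>s = Neg (foldr Imp \<psi>s Falsum)"
definition Exs :: "nat list \<Rightarrow> ('f, 'r) fm \<Rightarrow> ('f, 'r) fm" where
  "Exs vs \<psi> = foldr (\<lambda>v \<theta>. Neg (All v (Neg \<theta>))) vs \<psi>"

lemma sat_Neg [simp]: "sat M e (Neg \<psi>) \<longleftrightarrow> \<not> sat M e \<psi>"
  by (simp add: Neg_def)

lemma sat_Conj [simp]: "sat M e (Conj \<psi>s) \<longleftrightarrow> (\<forall>\<psi>\<in>set \<psi>s. sat M e \<psi>)"
proof -
  have "sat M e (foldr Imp \<psi>s Falsum) \<longleftrightarrow> \<not> (\<forall>\<psi>\<in>set \<psi>s. sat M e \<psi>)" by (induction \<psi>s) auto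
  then show ?thesis by (simp add: Conj_def)
qed

lemma sat_Exs:
  "sat M e (Exs vs \<psi>) \<longleftrightarrow>
    (\<exists>e'. (\<forall>v. v \<notin> set vs \<longrightarrow> e' v = e v) \<and> (\<forall>v\<in>set vs. e' v \<in> universe M) \<and> sat M e' \<psi>)"
proof (induction vs arbitrary: e)
  case Nil
  have "e' = e" if "\<forall>v. e' v = e v" for e' using that by auto
  then show ?case by (auto simp: Exs_def)
next
  case (Cons v vs)
  have "sat M e (Exs (v # vs) \<psi>) \<longleftrightarrow> (\<exists>d\<in>universe M. sat M (e(v := d)) (Exs vs \<psi>))"
    by (simp add: Exs_def)
  also have "\<dots> \<longleftrightarrow> (\<exists>d\<in>universe M. \<exists>e'. (\<forall>w. w \<notin> set vs \<longrightarrow> e' w = (e(v := d)) w) \<and>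
      (\<forall>v\<in>set vs. e' v \<in> universe M) \<and> sat M e' \<psi>)"
    by (simp only: Cons.IH)
  also have "\<dots> \<longleftrightarrow> (\<exists>e'. (\<forall>w. w \<notin> set (v # vs) \<longrightarrow> e' w = e w) \<and>
      (\<forall>w\<in>set (v # vs). e' w \<in> universe M) \<and> sat M e' \<psi>)" (is "?l \<longleftrightarrow> ?r")
  proof
    assume ?l
    then obtain d e' where d: "d \<in> universe M" "\<forall>w. w \<notin> set vs \<longrightarrow> e' w = (e(v := d)) w"
      "\<forall>v\<in>set vs. e' v \<in> universe M" "sat M e' \<psi>" by blast
    then have "e' v \<in> universe M" by (cases "v \<in> set vs") auto
    with d show ?r by (intro exI[of _ e']) auto
  next
    assume ?r
    then obtain e' where e': "\<forall>w. w \<notin> set (v # vs) \<longrightarrow> e' w = e w"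
      "\<forall>w\<in>set (v # vs). e' w \<in> universe M" "sat M e' \<psi>" by blast
    show ?l by (rule bexI[of _ "e' v"], rule exI[of _ e']) (use e' in auto)
  qed
  finally show ?case .
qed

lemma is_formula_Neg [simp]: "is_formula L (Neg \<psi>) \<longleftrightarrow> is_formula L \<psi>"
  by (simp add: Neg_def)

lemma is_formula_Conj [simp]: "is_formula L (Conj \<psi>s) \<longleftrightarrow> (\<forall>\<psi>\<in>set \<psi>s. is_formula L \<psi>)"
proof -
  have "is_formula L (foldr Imp \<psi>s Falsum) \<longleftrightarrow> (\<forall>\<psi>\<in>set \<psi>s. is_formula L \<psi>)" by (induction \<psi>s) auto
  then show ?thesis by (simp add: Conj_def)
qed

lemma is_formula_Exs [simp]: "is_formula L (Exs vs \<psi>) \<longleftrightarrow> is_formula L \<psi>"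
  by (induction vs) (auto simp: Exs_def)

lemma elementary_embeddingD:
  assumes "elementary_embedding L h M N" "is_formula L \<psi>" "range e \<subseteq> universe M"
  shows "sat N (\<lambda>v. h (e v)) \<psi> = sat M e \<psi>"
  using assms by (simp add: elementary_embedding_def comp_def)

lemma elementary_embedding_model:
  assumes h: "elementary_embedding L h M N" and T: "\<forall>\<sigma>\<in>T. is_sentence L \<sigma>"
  shows "is_model L T M \<longleftrightarrow> is_model L T N"
proof -
  have str: "is_structure L M" "is_structure L N" and hM: "h ` universe M \<subseteq> universe N"
    using h by (auto simp: elementary_embedding_def)
  obtain u where u: "u \<in> universe M" using str(1) by (auto simp: is_structure_def)
  have s: "sat N e \<sigma> = sat M e' \<sigma>" if "\<sigma> \<in> T" for e e' \<sigma>
  proof -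
    have f: "fv \<sigma> = {}" "is_formula L \<sigma>" using T that by (auto simp: is_sentence_def)
    have "sat N e \<sigma> = sat N (\<lambda>v. h ((\<lambda>_. u) v)) \<sigma>" by (rule sat_cong) (simp add: f)
    also have "\<dots> = sat M (\<lambda>_. u) \<sigma>" by (rule elementary_embeddingD[OF h f(2)]) (use u in auto)
    also have "\<dots> = sat M e' \<sigma>" by (rule sat_cong) (simp add: f)
    finally show ?thesis .
  qed
  have uN: "h u \<in> universe N" using u hM by blast
  have "is_model L T M \<longleftrightarrow> (\<forall>\<sigma>\<in>T. sat M (\<lambda>_. u) \<sigma>)"
    unfolding is_model_def using str(1) u s by (metis image_subset_iff)
  moreover have "is_model L T N \<longleftrightarrow> (\<forall>\<sigma>\<in>T. sat N (\<lambda>_. h u) \<sigma>)"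
    unfolding is_model_def using str(2) uN s by (metis image_subset_iff)
  ultimately show ?thesis using s by blast
qed

lemma tuples_append: "a \<in> tuples m M \<Longrightarrow> b \<in> tuples n M \<Longrightarrow> length (a @ b) = m + n \<and> set (a @ b) \<subseteq> universe M"
  by (auto simp: tuples_def)

lemma val_embedding:
  assumes h: "elementary_embedding L h M N" and \<phi>: "is_formula L \<phi>" "fv \<phi> \<subseteq> set (xs @ ys)"
    and ab: "a \<in> tuples (length xs) M" "b \<in> tuples (length ys) M"
  shows "val N \<phi> xs ys (map h a) (map h b) = val M \<phi> xs ys a b"
proof -
  obtain u where u: "u \<in> universe M" using h by (auto simp: elementary_embedding_def is_structure_def)
  have l: "length (a @ b) = length (xs @ ys)" "set (a @ b) \<subseteq> universe M"
    using tuples_append[OF ab] by auto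
  have "sat N (assign (\<lambda>_. undefined) (xs @ ys) (map h (a @ b))) \<phi> =
     sat N (assign (\<lambda>v. h ((\<lambda>_. u) v)) (xs @ ys) (map h (a @ b))) \<phi>"
    by (rule sat_assign_irrelevant[OF \<phi>(2)]) (use l in simp)
  also have "\<dots> = sat N (\<lambda>v. h (assign (\<lambda>_. u) (xs @ ys) (a @ b) v)) \<phi>"
    by (rule arg_cong[of _ _ "\<lambda>e. sat N e \<phi>"]) (rule ext, rule assign_map)
  also have "\<dots> = sat M (assign (\<lambda>_. u) (xs @ ys) (a @ b)) \<phi>"
    by (rule elementary_embeddingD[OF h \<phi>(1)]) (use assign_range[OF l] u in auto)
  also have "\<dots> = sat M (assign (\<lambda>_. undefined) (xs @ ys) (a @ b)) \<phi>"
    by (rule sat_assign_irrelevant[OF \<phi>(2) l(1)])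
  finally show ?thesis by (simp add: val_def)
qed

lemma elementary_extension_tuples: "elementary_extension L M N \<Longrightarrow> tuples n M \<subseteq> tuples n N"
  by (auto simp: elementary_extension_def tuples_def)

lemma val_extension:
  assumes "elementary_extension L M N" "is_formula L \<phi>" "fv \<phi> \<subseteq> set (xs @ ys)"
    "a \<in> tuples (length xs) M" "b \<in> tuples (length ys) M"
  shows "val N \<phi> xs ys a b = val M \<phi> xs ys a b"
  using val_embedding[of L "\<lambda>u. u" M N \<phi> xs ys a b] assms by (simp add: elementary_extension_def)

section \<open>Countable elementary substructures\<close>

lemma tval_universe_update: "tval (N\<lparr>universe := K\<rparr>) e t = tval N e t"
proof (induction t)
  case (Fun g ts)
  then have "map (tval (N\<lparr>universe := K\<rparr>) e) ts = map (tval N e) ts" by simp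
  then show ?case by (simp del: map_eq_conv)
qed simp

text \<open>Closure of \<open>K\<close> under the functions of the language is itself an instance of the witness
  condition, for the formula stating that a variable is the value of the function.\<close>

lemma tarski_vaught:
  assumes N: "is_structure L N" and K: "K \<subseteq> universe N" "K \<noteq> {}"
    and tv: "\<And>\<psi> v e d. is_formula L \<psi> \<Longrightarrow> range e \<subseteq> K \<Longrightarrow> d \<in> universe N \<Longrightarrow> sat N (e(v := d)) \<psi> \<Longrightarrow>
       \<exists>d\<in>K. sat N (e(v := d)) \<psi>"
  shows "elementary_extension L (N\<lparr>universe := K\<rparr>) N"
proof -
  have "fint N g c \<in> K" if g: "g \<in> Funs L" and c: "length c = farity L g" "set c \<subseteq> K" for g c
  proof -
    obtain k where k: "k \<in> K" using K by blast
    define n where "n = farity L g"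
    define e where "e i = (if i < n then c ! i else k)" for i
    have e: "range e \<subseteq> K" using c k by (auto simp: e_def n_def)
    have m: "map (\<lambda>v. tval N (e(n := d)) (Var v)) [0..<n] = c" for d
      using c by (auto simp: e_def n_def intro!: nth_equalityI)
    have s: "sat N (e(n := d)) (Equal (Fun g (map Var [0..<n])) (Var n)) \<longleftrightarrow> d = fint N g c" for d
      using m[of d] by (auto simp: comp_def)
    have "fint N g c \<in> universe N" using N g c K by (auto simp: is_structure_def tuples_def)
    with tv[OF _ e, of "Equal (Fun g (map Var [0..<n])) (Var n)" _ n] s g show ?thesis
      by (auto simp: n_def)
  qed
  then have sK: "is_structure L (N\<lparr>universe := K\<rparr>)"
    using K(2) by (auto simp: is_structure_def tuples_def)
  have "sat (N\<lparr>universe := K\<rparr>) e \<psi> = sat N e \<psi>" if "is_formula L \<psi>" "range e \<subseteq> K" for e \<psi>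
    using that
  proof (induction \<psi> arbitrary: e)
    case (All v \<psi>)
    have "sat (N\<lparr>universe := K\<rparr>) (e(v := d)) \<psi> = sat N (e(v := d)) \<psi>" if "d \<in> K" for d
      by (rule All.IH) (use All.prems that in auto)
    then have "sat (N\<lparr>universe := K\<rparr>) e (All v \<psi>) \<longleftrightarrow> (\<forall>d\<in>K. sat N (e(v := d)) \<psi>)" by simp
    also have "\<dots> \<longleftrightarrow> (\<forall>d\<in>universe N. sat N (e(v := d)) \<psi>)"
      using tv[of "Neg \<psi>" e _ v] All.prems K(1) by auto
    finally show ?case by simp
  qed (auto simp: tval_universe_update cong: map_cong)
  then show ?thesis using K(1) sK N
    by (auto simp: elementary_extension_def elementary_embedding_def comp_def)
qed

text \<open>Closing under witnesses \<open>w (\<psi>, v, c)\<close> suffices.  The assignment enters through the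
  finite list \<open>c\<close> of its values at an initial segment of the variables, which keeps the number of
  witnesses added at each stage countable.\<close>

lemma downward_loewenheim_skolem:
  assumes L: "countable_language L" and N: "is_structure L N"
    and A: "countable A" "A \<subseteq> universe N"
  obtains K where "A \<subseteq> K" "countable K" "elementary_extension L (N\<lparr>universe := K\<rparr>) N"
proof -
  obtain u where u: "u \<in> universe N" using N by (auto simp: is_structure_def)
  define env where "env c = (\<lambda>v. if v < length c then c ! v else u)" for c
  define w where "w = (\<lambda>(\<psi>, v, c). if \<exists>d\<in>universe N. sat N ((env c)(v := d)) \<psi>
      then SOME d. d \<in> universe N \<and> sat N ((env c)(v := d)) \<psi> else u)"
  have w: "w p \<in> universe N" for p
    unfolding w_def by (cases p) (auto intro: someI2_ex u)
  define step where "step X = X \<union> w ` ({\<psi>. is_formula L \<psi>} \<times> UNIV \<times> lists X)" for X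
  define Ks where "Ks n = (step ^^ n) (insert u A)" for n
  have KsS: "Ks (Suc n) = step (Ks n)" for n by (simp add: Ks_def)
  have cK: "countable (Ks n)" for n
  proof (induction n)
    case 0
    then show ?case using A(1) by (simp add: Ks_def)
  next
    case (Suc n)
    then show ?case unfolding KsS step_def
      by (intro countable_Un countable_image countable_SIGMA countable_formulas[OF L]) auto
  qed
  have uK: "Ks n \<subseteq> universe N" for n
  proof (induction n)
    case 0
    then show ?case using A(2) u by (simp add: Ks_def)
  next
    case (Suc n)
    then show ?case unfolding KsS step_def using w by auto
  qed
  have mono: "Ks m \<subseteq> Ks n" if "m \<le> n" for m n
    by (rule lift_Suc_mono_le[OF _ that]) (auto simp: KsS step_def)
  define K where "K = (\<Union>n. Ks n)"
  have A0: "insert u A \<subseteq> K"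
  proof -
    have "Ks 0 = insert u A" by (simp add: Ks_def)
    then show ?thesis unfolding K_def by blast
  qed
  have fin: "\<exists>n. set c \<subseteq> Ks n" if "set c \<subseteq> K" for c
    using that
  proof (induction c)
    case (Cons x c)
    then obtain n where n: "set c \<subseteq> Ks n" by auto
    obtain m where m: "x \<in> Ks m" using Cons.prems by (auto simp: K_def)
    have "set (x # c) \<subseteq> Ks (max m n)" using n m mono[of m "max m n"] mono[of n "max m n"] by auto
    then show ?case ..
  qed auto
  have "elementary_extension L (N\<lparr>universe := K\<rparr>) N"
  proof (rule tarski_vaught[OF N])
    show "K \<subseteq> universe N" using uK by (auto simp: K_def)
    show "K \<noteq> {}" using A0 by auto
    fix \<psi> :: "('a, 'b) fm" and v e d
    assume \<psi>: "is_formula L \<psi>" and e: "range e \<subseteq> K" and d: "d \<in> universe N" "sat N (e(v := d)) \<psi>"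
    obtain b where b: "\<forall>x\<in>fv \<psi>. x < b" using finite_fv[of \<psi>] finite_nat_set_iff_bounded by blast
    define c where "c = map e [0..<b]"
    have eq: "sat N ((env c)(v := d)) \<psi> = sat N (e(v := d)) \<psi>" for d
      by (rule sat_cong) (use b in \<open>auto simp: env_def c_def\<close>)
    have "set c \<subseteq> K" using e by (auto simp: c_def)
    then obtain n where "set c \<subseteq> Ks n" using fin by blast
    then have "w (\<psi>, v, c) \<in> Ks (Suc n)" unfolding KsS step_def using \<psi> by blast
    then have "w (\<psi>, v, c) \<in> K" by (auto simp: K_def)
    moreover have "\<exists>d\<in>universe N. sat N ((env c)(v := d)) \<psi>" using d eq by blast
    then have "sat N ((env c)(v := w (\<psi>, v, c))) \<psi>"
      unfolding w_def prod.case by (simp only: if_True) (rule someI2_ex, blast, blast)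
    ultimately show "\<exists>d\<in>K. sat N (e(v := d)) \<psi>" using eq by blast
  qed
  moreover have "countable K" using cK by (simp add: K_def)
  ultimately show ?thesis using that A0 by blast
qed

section \<open>Renaming of variables\<close>

text \<open>The conjunction of instances \<open>\<phi>(a\<^sub>i, y)\<close> at several parameter tuples needs disjoint
  copies of the variables \<open>x\<close>.  Renaming bound and free variables alike by an injective map
  avoids all capture.\<close>

primrec rename_trm :: "(nat \<Rightarrow> nat) \<Rightarrow> 'f trm \<Rightarrow> 'f trm" where
  "rename_trm \<pi> (Var v) = Var (\<pi> v)"
| "rename_trm \<pi> (Fun g ts) = Fun g (map (rename_trm \<pi>) ts)"

primrec rename :: "(nat \<Rightarrow> nat) \<Rightarrow> ('f, 'r) fm \<Rightarrow> ('f, 'r) fm" where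
  "rename \<pi> Falsum = Falsum"
| "rename \<pi> (Equal s t) = Equal (rename_trm \<pi> s) (rename_trm \<pi> t)"
| "rename \<pi> (Rel R ts) = Rel R (map (rename_trm \<pi>) ts)"
| "rename \<pi> (Imp \<psi> \<theta>) = Imp (rename \<pi> \<psi>) (rename \<pi> \<theta>)"
| "rename \<pi> (All v \<psi>) = All (\<pi> v) (rename \<pi> \<psi>)"

lemma tval_rename: "tval M e (rename_trm \<pi> t) = tval M (\<lambda>v. e (\<pi> v)) t"
proof (induction t)
  case (Fun g ts)
  then have "map (tval M e) (map (rename_trm \<pi>) ts) = map (tval M (\<lambda>v. e (\<pi> v))) ts" by simp
  then show ?case by (simp only: rename_trm.simps tval.simps)
qed simp

lemma sat_rename:
  assumes "inj \<pi>"
  shows "sat M e (rename \<pi> \<psi>) = sat M (\<lambda>v. e (\<pi> v)) \<psi>"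
proof (induction \<psi> arbitrary: e)
  case (All v \<psi>)
  have "(\<lambda>w. (e(\<pi> v := d)) (\<pi> w)) = (\<lambda>w. e (\<pi> w))(v := d)" for d
    using assms by (auto simp: fun_eq_iff inj_eq)
  then show ?case by (simp add: All.IH)
qed (simp_all add: tval_rename comp_def)

lemma is_term_rename: "is_term L t \<Longrightarrow> is_term L (rename_trm \<pi> t)"
  by (induction t) auto

lemma is_formula_rename: "is_formula L \<psi> \<Longrightarrow> is_formula L (rename \<pi> \<psi>)"
  by (induction \<psi>) (auto simp: is_term_rename)

section \<open>Ultrapowers along an ultrafilter on the natural numbers\<close>

text \<open>The elements of the ultrapower are coded in an arbitrary type by an injection \<open>j\<close> from the
  sequences in \<open>M\<close>: the class of a sequence is the code of a chosen member of the class.  In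
  this way the ultrapower of a structure with at most continuum many elements can be formed
  within any type that has at least continuum many elements.\<close>

locale ultrapower =
  fixes L :: "('f, 'r) language" and M :: "('f, 'r, 'u) struct"
    and U :: "nat filter" and j :: "(nat \<Rightarrow> 'u) \<Rightarrow> 'v"
  assumes ultra: "ultra U"
    and M: "is_structure L M"
    and j: "inj_on j {f. range f \<subseteq> universe M}"
begin

definition seqs :: "(nat \<Rightarrow> 'u) set" where
  "seqs = {f. range f \<subseteq> universe M}"

definition cls :: "(nat \<Rightarrow> 'u) \<Rightarrow> 'v" where
  "cls f = j (SOME g. g \<in> seqs \<and> eventually (\<lambda>n. g n = f n) U)"

definition rep :: "'v \<Rightarrow> nat \<Rightarrow> 'u" where
  "rep = inv_into seqs j"

definition upower :: "('f, 'r, 'v) struct" where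
  "upower = \<lparr>universe = cls ` seqs,
     fint = (\<lambda>g cs. cls (\<lambda>n. fint M g (map (\<lambda>c. rep c n) cs))),
     rint = (\<lambda>R cs. eventually (\<lambda>n. rint M R (map (\<lambda>c. rep c n) cs)) U)\<rparr>"

lemma rep_cls:
  assumes "f \<in> seqs"
  shows "rep (cls f) \<in> seqs" "eventually (\<lambda>n. rep (cls f) n = f n) U"
proof -
  define g where "g = (SOME g. g \<in> seqs \<and> eventually (\<lambda>n. g n = f n) U)"
  have "g \<in> seqs \<and> eventually (\<lambda>n. g n = f n) U"
    unfolding g_def by (rule someI[of _ f]) (simp add: assms)
  moreover have "cls f = j g" by (simp add: cls_def g_def)
  moreover have "inj_on j seqs" using j by (simp add: seqs_def)
  then have "rep (j g) = g" unfolding rep_def by (rule inv_into_f_f) (use calculation in blast)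
  ultimately show "rep (cls f) \<in> seqs" "eventually (\<lambda>n. rep (cls f) n = f n) U" by simp_all
qed

lemma cls_eq_iff:
  assumes "f \<in> seqs" "g \<in> seqs"
  shows "cls f = cls g \<longleftrightarrow> eventually (\<lambda>n. f n = g n) U"
proof
  assume "cls f = cls g"
  with rep_cls(2)[OF assms(1)] rep_cls(2)[OF assms(2)] show "eventually (\<lambda>n. f n = g n) U"
    by (auto elim: eventually_elim2)
next
  assume e: "eventually (\<lambda>n. f n = g n) U"
  have "eventually (\<lambda>n. h n = f n) U \<longleftrightarrow> eventually (\<lambda>n. h n = g n) U" for h :: "nat \<Rightarrow> 'u"
    by (rule eventually_cong[OF e]) simp
  then show "cls f = cls g" by (simp add: cls_def)
qed

lemma upower_universe: "universe upower = cls ` seqs"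
  by (simp add: upower_def)

lemma cls_rep: "x \<in> universe upower \<Longrightarrow> rep x \<in> seqs \<and> cls (rep x) = x"
  using rep_cls cls_eq_iff by (auto simp: upower_universe)

lemma eventually_map_rep:
  assumes "\<And>f. f \<in> set fs \<Longrightarrow> f \<in> seqs"
  shows "eventually (\<lambda>n. map (\<lambda>c. rep c n) (map cls fs) = map (\<lambda>f. f n) fs) U"
proof -
  have "eventually (\<lambda>n. \<forall>f\<in>set fs. rep (cls f) n = f n) U"
    by (rule eventually_ball_finite) (use assms rep_cls(2) in auto)
  then show ?thesis by (rule eventually_mono) auto
qed

lemma seqs_nonempty: "\<exists>f. f \<in> seqs"
  using M by (auto simp: is_structure_def seqs_def intro: exI[of _ "\<lambda>_. u" for u])

lemma seqs_fint:
  assumes "g \<in> Funs L" "length fs = farity L g" "\<And>f. f \<in> set fs \<Longrightarrow> f \<in> seqs"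
  shows "(\<lambda>n. fint M g (map (\<lambda>f. f n) fs)) \<in> seqs"
proof -
  have "map (\<lambda>f. f n) fs \<in> tuples (farity L g) M" for n
    using assms(2,3) by (auto simp: tuples_def seqs_def)
  then show ?thesis using M assms(1) by (auto simp: is_structure_def seqs_def)
qed

lemma fint_upower:
  assumes "g \<in> Funs L" "length fs = farity L g" "\<And>f. f \<in> set fs \<Longrightarrow> f \<in> seqs"
  shows "fint upower g (map cls fs) = cls (\<lambda>n. fint M g (map (\<lambda>f. f n) fs))"
proof -
  have r: "rep (cls f) \<in> seqs" if "f \<in> set fs" for f using rep_cls(1) assms(3) that by blast
  have "(\<lambda>n. fint M g (map (\<lambda>f. f n) (map (\<lambda>f. rep (cls f)) fs))) \<in> seqs"
    by (rule seqs_fint) (use assms r in auto)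
  then have s: "(\<lambda>n. fint M g (map (\<lambda>c. rep c n) (map cls fs))) \<in> seqs" by (simp add: comp_def)
  have "cls (\<lambda>n. fint M g (map (\<lambda>c. rep c n) (map cls fs))) = cls (\<lambda>n. fint M g (map (\<lambda>f. f n) fs))"
  proof (rule iffD2[OF cls_eq_iff[OF s]])
    show "(\<lambda>n. fint M g (map (\<lambda>f. f n) fs)) \<in> seqs"
      by (rule seqs_fint[OF assms(1,2)]) (rule assms(3))
    have "eventually (\<lambda>n. map (\<lambda>c. rep c n) (map cls fs) = map (\<lambda>f. f n) fs) U"
      by (rule eventually_map_rep) (rule assms(3))
    then show "eventually (\<lambda>n. fint M g (map (\<lambda>c. rep c n) (map cls fs)) =
        fint M g (map (\<lambda>f. f n) fs)) U"
      by (rule eventually_mono) (erule arg_cong)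
  qed
  then show ?thesis by (simp add: upower_def)
qed

lemma structure_upower: "is_structure L upower"
proof -
  have "fint upower g c \<in> universe upower" if g: "g \<in> Funs L" and c: "c \<in> tuples (farity L g) upower" for g c
  proof -
    have "map cls (map rep c) = c" using c cls_rep by (auto simp: tuples_def intro!: map_idI)
    moreover have "fint upower g (map cls (map rep c)) = cls (\<lambda>n. fint M g (map (\<lambda>f. f n) (map rep c)))"
      by (rule fint_upower[OF g]) (use c cls_rep in \<open>auto simp: tuples_def\<close>)
    moreover have "(\<lambda>n. fint M g (map (\<lambda>f. f n) (map rep c))) \<in> seqs"
      by (rule seqs_fint[OF g]) (use c cls_rep in \<open>auto simp: tuples_def\<close>)
    ultimately show ?thesis by (simp only: upower_universe image_eqI)
  qed
  then show ?thesis using seqs_nonempty by (auto simp: is_structure_def upower_universe)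
qed

lemma tval_upower:
  assumes F: "\<And>v. F v \<in> seqs"
  shows "is_term L t \<Longrightarrow> tval upower (\<lambda>v. cls (F v)) t = cls (\<lambda>n. tval M (\<lambda>v. F v n) t) \<and>
    (\<lambda>n. tval M (\<lambda>v. F v n) t) \<in> seqs"
proof (induction t)
  case (Fun g ts)
  define fs where "fs = map (\<lambda>t n. tval M (\<lambda>v. F v n) t) ts"
  have fs: "length fs = farity L g" "\<And>f. f \<in> set fs \<Longrightarrow> f \<in> seqs" "g \<in> Funs L"
    using Fun by (auto simp: fs_def)
  have m: "map (\<lambda>f. f n) fs = map (tval M (\<lambda>v. F v n)) ts" for n by (simp add: fs_def)
  have "map (tval upower (\<lambda>v. cls (F v))) ts = map cls fs"
    using Fun by (auto simp: fs_def)
  then have "tval upower (\<lambda>v. cls (F v)) (Fun g ts) = fint upower g (map cls fs)"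
    by (simp only: tval.simps)
  then show ?case
    using fint_upower[OF fs(3) fs(1,2)] seqs_fint[OF fs(3) fs(1,2)] unfolding m by simp
qed (use F in simp)

text \<open>Los's theorem, stated for assignments that are presented by sequences, so that updating an
  assignment in the ultrapower corresponds to updating it in every coordinate.\<close>

lemma los:
  "is_formula L \<psi> \<Longrightarrow> (\<And>v. F v \<in> seqs) \<Longrightarrow>
    sat upower (\<lambda>v. cls (F v)) \<psi> \<longleftrightarrow> eventually (\<lambda>n. sat M (\<lambda>v. F v n) \<psi>) U"
proof (induction \<psi> arbitrary: F)
  case Falsum
  then show ?case using ultra by (simp add: ultra_def trivial_limit_def)
next
  case (Equal s t)
  then show ?case
    using tval_upower[of F s] tval_upower[of F t] by (simp add: cls_eq_iff)
next
  case (Rel R ts)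
  define fs where "fs = map (\<lambda>t n. tval M (\<lambda>v. F v n) t) ts"
  have fs: "\<And>f. f \<in> set fs \<Longrightarrow> f \<in> seqs" using Rel tval_upower by (auto simp: fs_def)
  have m: "map (\<lambda>f. f n) fs = map (tval M (\<lambda>v. F v n)) ts" for n by (simp add: fs_def)
  have "map (tval upower (\<lambda>v. cls (F v))) ts = map cls fs"
    using Rel tval_upower by (auto simp: fs_def)
  then have "sat upower (\<lambda>v. cls (F v)) (Rel R ts) = rint upower R (map cls fs)"
    by (simp only: sat.simps)
  also have "\<dots> = eventually (\<lambda>n. rint M R (map (\<lambda>c. rep c n) (map cls fs))) U"
    by (simp add: upower_def)
  also have "\<dots> = eventually (\<lambda>n. rint M R (map (\<lambda>f. f n) fs)) U"
    by (rule eventually_cong[OF eventually_map_rep[OF fs]]) (assumption, erule arg_cong)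
  finally show ?case by (simp only: m sat.simps)
next
  case (Imp \<psi> \<theta>)
  then show ?case by (simp add: ultra_imp[OF ultra])
next
  case (All v \<psi>)
  have upd: "sat upower ((\<lambda>w. cls (F w))(v := cls f)) \<psi> \<longleftrightarrow>
     eventually (\<lambda>n. sat M ((\<lambda>w. F w n)(v := f n)) \<psi>) U" if f: "f \<in> seqs" for f
  proof -
    have "(\<lambda>w. cls (F w))(v := cls f) = (\<lambda>w. cls ((F(v := f)) w))"
      "(\<lambda>w. F w n)(v := f n) = (\<lambda>w. (F(v := f)) w n)" for n by auto
    then show ?thesis using All.IH[of "F(v := f)"] All.prems f by simp
  qed
  have "sat upower (\<lambda>v. cls (F v)) (All v \<psi>) \<longleftrightarrow>
    (\<forall>f\<in>seqs. eventually (\<lambda>n. sat M ((\<lambda>w. F w n)(v := f n)) \<psi>) U)"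
    using upd by (simp add: upower_universe)
  also have "\<dots> \<longleftrightarrow> eventually (\<lambda>n. \<forall>d\<in>universe M. sat M ((\<lambda>w. F w n)(v := d)) \<psi>) U" (is "?l \<longleftrightarrow> ?r")
  proof
    assume ?r
    have "eventually (\<lambda>n. sat M ((\<lambda>w. F w n)(v := f n)) \<psi>) U" if "f \<in> seqs" for f
      using \<open>?r\<close> by (rule eventually_mono) (use that in \<open>auto simp: seqs_def\<close>)
    then show ?l ..
  next
    assume l: ?l
    \<comment> \<open>A sequence that takes a counterexample wherever there is one.\<close>
    define bad where "bad n d \<longleftrightarrow> d \<in> universe M \<and> \<not> sat M ((\<lambda>w. F w n)(v := d)) \<psi>" for n d
    obtain u where u: "u \<in> universe M" using M by (auto simp: is_structure_def)
    define f where "f n = (if \<exists>d. bad n d then SOME d. bad n d else u)" for n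
    have fb: "bad n (f n)" if "\<exists>d. bad n d" for n
      using someI_ex[OF that] that by (simp add: f_def)
    have "f n \<in> universe M" for n
      using fb[of n] u by (cases "\<exists>d. bad n d") (auto simp: f_def bad_def)
    then have "f \<in> seqs" by (auto simp: seqs_def)
    with l have "eventually (\<lambda>n. sat M ((\<lambda>w. F w n)(v := f n)) \<psi>) U" by blast
    then show ?r by (rule eventually_mono) (use fb in \<open>auto simp: bad_def\<close>)
  qed
  finally show ?case by simp
qed

lemma elementary_diagonal: "elementary_embedding L (\<lambda>u. cls (\<lambda>_. u)) M upower"
proof -
  have "sat upower (\<lambda>v. cls (\<lambda>_. e v)) \<psi> = sat M e \<psi>" if "is_formula L \<psi>" "range e \<subseteq> universe M" for e \<psi>
  proof -
    have "sat upower (\<lambda>v. cls (\<lambda>_. e v)) \<psi> = eventually (\<lambda>n. sat M (\<lambda>v. e v) \<psi>) U"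
      using los[OF that(1), of "\<lambda>v _. e v"] that(2) by (auto simp: seqs_def)
    then show ?thesis using ultra by (simp add: ultra_def eventually_const)
  qed
  then show ?thesis
    using M structure_upower
    by (auto simp: elementary_embedding_def comp_def upower_universe seqs_def)
qed

definition cls_tuple :: "nat \<Rightarrow> (nat \<Rightarrow> 'u list) \<Rightarrow> 'v list" where
  "cls_tuple m c = map (\<lambda>i. cls (\<lambda>n. c n ! i)) [0..<m]"

lemma cls_tuple_in_tuples:
  assumes "\<And>n. c n \<in> tuples m M" shows "cls_tuple m c \<in> tuples m upower"
proof -
  have "c n ! i \<in> universe M" if "i < m" for i n
    using assms[of n] that nth_mem[of i "c n"] by (auto simp: tuples_def)
  then show ?thesis by (auto simp: cls_tuple_def tuples_def upower_universe seqs_def)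
qed

lemma tuples_upower:
  assumes "x \<in> tuples m upower"
  obtains c where "\<And>n. c n \<in> tuples m M" "x = cls_tuple m c"
proof -
  define c where "c n = map (\<lambda>x. rep x n) x" for n
  have "c n \<in> tuples m M" for n
    using assms cls_rep by (fastforce simp: tuples_def c_def seqs_def)
  moreover have "x = cls_tuple m c"
  proof (rule nth_equalityI)
    show "length x = length (cls_tuple m c)" using assms by (simp add: cls_tuple_def tuples_def)
    fix i assume i: "i < length x"
    then have "x ! i \<in> universe upower" using assms by (auto simp: tuples_def)
    then show "x ! i = cls_tuple m c ! i" using cls_rep[of "x ! i"] assms i
      by (simp add: cls_tuple_def c_def tuples_def)
  qed
  ultimately show ?thesis using that by blast
qed

lemma los_tuples:
  assumes \<psi>: "is_formula L \<psi>" and vs: "distinct vs" and c: "\<And>n. c n \<in> tuples (length vs) M"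
    and E: "\<And>v. E v \<in> seqs"
  shows "sat upower (assign (\<lambda>v. cls (E v)) vs (cls_tuple (length vs) c)) \<psi> \<longleftrightarrow>
    eventually (\<lambda>n. sat M (assign (\<lambda>v. E v n) vs (c n)) \<psi>) U"
proof -
  define F where "F v = (\<lambda>n. assign (\<lambda>v. E v n) vs (c n) v)" for v
  have len: "length (c n) = length vs" for n using c by (simp add: tuples_def)
  have "F v \<in> seqs" for v
  proof -
    have "assign (\<lambda>v. E v n) vs (c n) v \<in> universe M" for n
    proof -
      have "range (assign (\<lambda>v. E v n) vs (c n)) \<subseteq> universe M"
        by (rule assign_range) (use c E in \<open>auto simp: tuples_def seqs_def image_subset_iff\<close>)
      then show ?thesis by blast
    qed
    then show ?thesis by (auto simp: F_def seqs_def)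
  qed
  moreover have "assign (\<lambda>v. cls (E v)) vs (cls_tuple (length vs) c) = (\<lambda>v. cls (F v))"
  proof
    fix v
    show "assign (\<lambda>v. cls (E v)) vs (cls_tuple (length vs) c) v = cls (F v)"
    proof (cases "v \<in> set vs")
      case True
      then obtain i where i: "i < length vs" "v = vs ! i" by (auto simp: in_set_conv_nth)
      have "F v = (\<lambda>n. c n ! i)" unfolding F_def i(2) by (simp add: assign_nth[OF vs len i(1)])
      moreover have "assign (\<lambda>v. cls (E v)) vs (cls_tuple (length vs) c) (vs ! i) = cls_tuple (length vs) c ! i"
        by (rule assign_nth[OF vs _ i(1)]) (simp add: cls_tuple_def)
      ultimately show ?thesis using i by (simp add: cls_tuple_def)
    next
      case False
      then show ?thesis by (simp add: F_def assign_notin)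
    qed
  qed
  ultimately show ?thesis using los[OF \<psi>, of F] by (simp add: F_def)
qed

lemma los_val:
  assumes \<phi>: "is_formula L \<phi>" "fv \<phi> \<subseteq> set (xs @ ys)" and d: "distinct (xs @ ys)"
    and a: "\<And>n. a n \<in> tuples (length xs) M" and b: "\<And>n. b n \<in> tuples (length ys) M"
  shows "val upower \<phi> xs ys (cls_tuple (length xs) a) (cls_tuple (length ys) b) = 0 \<longleftrightarrow>
    eventually (\<lambda>n. val M \<phi> xs ys (a n) (b n) = 0) U"
proof -
  obtain f where f: "f \<in> seqs" using seqs_nonempty by blast
  have la: "length (a n) = length xs" for n using a by (simp add: tuples_def)
  have lb: "length (b n) = length ys" for n using b by (simp add: tuples_def)
  have app: "cls_tuple (length xs) a @ cls_tuple (length ys) b = cls_tuple (length (xs @ ys)) (\<lambda>n. a n @ b n)"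
    by (rule nth_equalityI) (auto simp: cls_tuple_def nth_append la)
  have "sat upower (assign (\<lambda>_. cls f) (xs @ ys) (cls_tuple (length (xs @ ys)) (\<lambda>n. a n @ b n))) \<phi> \<longleftrightarrow>
    eventually (\<lambda>n. sat M (assign (\<lambda>_. f n) (xs @ ys) (a n @ b n)) \<phi>) U"
    by (rule los_tuples[OF \<phi>(1) d]) (use a b f in \<open>auto simp: tuples_def\<close>)
  moreover have "sat M (assign (\<lambda>_. f n) (xs @ ys) (a n @ b n)) \<phi> =
     sat M (assign (\<lambda>_. undefined) (xs @ ys) (a n @ b n)) \<phi>" for n
    by (rule sat_assign_irrelevant[OF \<phi>(2)]) (simp add: la lb)
  moreover have "sat upower (assign (\<lambda>_. cls f) (xs @ ys) (cls_tuple (length (xs @ ys)) (\<lambda>n. a n @ b n))) \<phi> =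
    sat upower (assign (\<lambda>_. undefined) (xs @ ys) (cls_tuple (length (xs @ ys)) (\<lambda>n. a n @ b n))) \<phi>"
    by (rule sat_assign_irrelevant[OF \<phi>(2)]) (simp add: cls_tuple_def)
  ultimately show ?thesis by (simp add: val_def app)
qed

end

text \<open>In the coordinate \<open>n\<close> take the longest initial run of the conditions, up to index
  \<open>n\<close>, that can be met at once.  As \<open>U\<close> is nonprincipal, almost every coordinate
  has \<open>k \<le> n\<close>.\<close>

lemma diagonal_choice:
  fixes S :: "nat \<Rightarrow> nat \<Rightarrow> 'c \<Rightarrow> bool"
  assumes U: "U \<le> sequentially" and C: "C \<noteq> {}"
    and ev: "\<And>k. eventually (\<lambda>n. \<exists>c\<in>C. \<forall>i\<le>k. S i n c) U"
  obtains c where "\<And>n. c n \<in> C" "\<And>k. eventually (\<lambda>n. S k n (c n)) U"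
proof -
  define K where "K n = {k. k \<le> n \<and> (\<exists>c\<in>C. \<forall>i\<le>k. S i n c)}" for n
  have fin: "finite (K n)" for n unfolding K_def by (rule finite_subset[of _ "{..n}"]) auto
  have "\<exists>c\<in>C. \<forall>k\<in>K n. S k n c" for n
  proof (cases "K n = {}")
    case True
    then show ?thesis using C by auto
  next
    case False
    then have "Max (K n) \<in> K n" using fin by simp
    then obtain c where "c \<in> C" "\<forall>i\<le>Max (K n). S i n c" by (auto simp: K_def)
    moreover have "k \<le> Max (K n)" if "k \<in> K n" for k using fin that by simp
    ultimately show ?thesis by blast
  qed
  then obtain c where c: "\<And>n. c n \<in> C" "\<And>n k. k \<in> K n \<Longrightarrow> S k n (c n)" by metis
  have "eventually (\<lambda>n. S k n (c n)) U" for k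
  proof -
    have "eventually (\<lambda>n. k \<le> n) U" using eventually_ge_at_top U by (metis filter_leD)
    then show ?thesis using ev[of k] by eventually_elim (rule c(2), simp add: K_def)
  qed
  then show ?thesis using that c(1) by blast
qed

context ultrapower begin

text \<open>A type over countably many parameters amounts to countably many conditions: only the
  parameters at free variables matter, so \<open>nrm\<close> resets the other values of an assignment to a
  fixed element.  Finite satisfiability becomes, by Los's theorem, simultaneous satisfiability of
  the first \<open>k\<close> conditions in almost every coordinate, and \<open>diagonal_choice\<close> provides one
  tuple for all conditions.\<close>

lemma saturated_upower:
  assumes L: "countable_language L" and U: "U \<le> sequentially"
  shows "saturated L upower"
  unfolding saturated_def
proof (intro allI impI, elim conjE)
  fix A vs and \<Gamma> :: "(('f, 'r) fm \<times> (nat \<Rightarrow> 'v)) set"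
  assume A: "A \<subseteq> universe upower" "countable A" and vs: "distinct vs"
    and \<Gamma>: "\<Gamma> \<subseteq> formulas_over L A vs"
    and fs: "\<forall>\<Delta>. finite \<Delta> \<and> \<Delta> \<subseteq> \<Gamma> \<longrightarrow> (\<exists>c\<in>tuples (length vs) upower. realizes upower vs c \<Delta>)"
  obtain u where u: "u \<in> universe upower" using structure_upower by (auto simp: is_structure_def)
  define nrm where "nrm = (\<lambda>(\<psi> :: ('f, 'r) fm, e). (\<psi>, \<lambda>v. if v \<in> fv \<psi> - set vs then e v else u))"
  have nrm_sat: "sat upower (assign e' vs c) \<psi>' = sat upower (assign e vs c) \<psi>"
    if "nrm (\<psi>, e) = (\<psi>', e')" "c \<in> tuples (length vs) upower" for \<psi> e \<psi>' e' c
  proof -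
    have eq: "\<psi>' = \<psi>" "e' = (\<lambda>v. if v \<in> fv \<psi> - set vs then e v else u)" using that by (auto simp: nrm_def)
    have len: "length c = length vs" using that(2) by (simp add: tuples_def)
    have "assign e' vs c v = assign e vs c v" if "v \<in> fv \<psi>" for v
      using assign_in(2)[OF len, of v e' e] assign_notin[of v vs e c] assign_notin[of v vs e' c] that
      by (cases "v \<in> set vs") (auto simp: eq(2))
    then show ?thesis unfolding eq(1) by (rule sat_cong)
  qed
  have cnt: "countable (nrm ` \<Gamma>)"
  proof (rule countable_subset)
    show "nrm ` \<Gamma> \<subseteq> (\<lambda>(\<psi>, l). (\<psi>, \<lambda>v. if v < length l then l ! v else u)) `
       ({\<psi>. is_formula L \<psi>} \<times> lists (insert u A))"
    proof
      fix x assume "x \<in> nrm ` \<Gamma>"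
      then obtain \<psi> e where x: "(\<psi>, e) \<in> \<Gamma>" "x = nrm (\<psi>, e)" by auto
      obtain b where b: "\<forall>x\<in>fv \<psi>. x < b" using finite_fv[of \<psi>] finite_nat_set_iff_bounded by blast
      define l where "l = map (\<lambda>v. if v \<in> fv \<psi> - set vs then e v else u) [0..<b]"
      have \<psi>: "is_formula L \<psi>" "e ` (fv \<psi> - set vs) \<subseteq> A" using x \<Gamma> by (auto simp: formulas_over_def)
      then have "l \<in> lists (insert u A)" by (auto simp: l_def image_subset_iff)
      moreover have "x = (\<psi>, \<lambda>v. if v < length l then l ! v else u)"
        using b by (auto simp: x(2) nrm_def l_def)
      ultimately show "x \<in> (\<lambda>(\<psi>, l). (\<psi>, \<lambda>v. if v < length l then l ! v else u)) `
         ({\<psi>. is_formula L \<psi>} \<times> lists (insert u A))"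
        using \<psi>(1) by (intro image_eqI[of _ _ "(\<psi>, l)"]) auto
    qed
    show "countable ((\<lambda>(\<psi>, l). (\<psi>, \<lambda>v. if v < length l then l ! v else u)) `
       ({\<psi>. is_formula L \<psi>} \<times> lists (insert u A)))"
      using A(2) countable_formulas[OF L] by (intro countable_image countable_SIGMA) auto
  qed
  show "\<exists>c\<in>tuples (length vs) upower. realizes upower vs c \<Gamma>"
  proof (cases "\<Gamma> = {}")
    case True
    then show ?thesis using fs by blast
  next
    case False
    define g where "g k = (SOME \<gamma>. \<gamma> \<in> \<Gamma> \<and> nrm \<gamma> = from_nat_into (nrm ` \<Gamma>) k)" for k :: nat
    have g: "g k \<in> \<Gamma> \<and> nrm (g k) = from_nat_into (nrm ` \<Gamma>) k" for k
    proof -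
      have "from_nat_into (nrm ` \<Gamma>) k \<in> nrm ` \<Gamma>" using False by (simp add: from_nat_into)
      then have "\<exists>\<gamma>. \<gamma> \<in> \<Gamma> \<and> nrm \<gamma> = from_nat_into (nrm ` \<Gamma>) k" by force
      then show ?thesis unfolding g_def by (rule someI_ex)
    qed
    define P where "P k = fst (nrm (g k))" for k
    define E where "E k v = rep (snd (nrm (g k)) v)" for k v
    have P: "is_formula L (P k)" for k
      using conjunct1[OF g[of k]] \<Gamma> by (cases "g k") (auto simp: P_def nrm_def formulas_over_def)
    have snd_in: "snd (nrm (g k)) v \<in> universe upower" for k v
      using conjunct1[OF g[of k]] \<Gamma> A(1) u by (cases "g k") (auto simp: nrm_def formulas_over_def)
    then have E: "E k v \<in> seqs" "cls (E k v) = snd (nrm (g k)) v" for k v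
      using cls_rep by (auto simp: E_def)
    define S where "S k n c = sat M (assign (\<lambda>v. E k v n) vs c) (P k)" for k n c
    have LS: "sat upower (assign (snd (g k)) vs (cls_tuple (length vs) c)) (fst (g k)) \<longleftrightarrow>
       eventually (\<lambda>n. S k n (c n)) U" if c: "\<And>n. c n \<in> tuples (length vs) M" for k c
    proof -
      have "sat upower (assign (snd (g k)) vs (cls_tuple (length vs) c)) (fst (g k)) =
        sat upower (assign (snd (nrm (g k))) vs (cls_tuple (length vs) c)) (P k)"
        using nrm_sat[of "fst (g k)" "snd (g k)" _ _ "cls_tuple (length vs) c"] cls_tuple_in_tuples[OF c] by (simp add: P_def)
      also have "snd (nrm (g k)) = (\<lambda>v. cls (E k v))" using E(2) by auto
      finally show ?thesis using los_tuples[OF P[of k] vs c E(1)[of k]] by (simp add: S_def)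
    qed
    have ne: "tuples (length vs) M \<noteq> {}"
    proof -
      obtain w where "w \<in> universe M" using M by (auto simp: is_structure_def)
      then have "replicate (length vs) w \<in> tuples (length vs) M" by (auto simp: tuples_def)
      then show ?thesis by blast
    qed
    have ev: "eventually (\<lambda>n. \<exists>c\<in>tuples (length vs) M. \<forall>i\<le>k. S i n c) U" for k
    proof -
      have "finite (g ` {..k}) \<and> g ` {..k} \<subseteq> \<Gamma>" using g by auto
      then obtain x where x: "x \<in> tuples (length vs) upower" "realizes upower vs x (g ` {..k})"
        using fs by blast
      obtain c where c: "\<And>n. c n \<in> tuples (length vs) M" "x = cls_tuple (length vs) c"
        using tuples_upower[OF x(1)] by blast
      have "eventually (\<lambda>n. S i n (c n)) U" if "i \<le> k" for i
        using LS[where c = c and k = i, OF c(1)] x(2) that unfolding c(2) realizes_def by (auto simp: case_prod_beta)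
      then have "eventually (\<lambda>n. \<forall>i\<in>{..k}. S i n (c n)) U" by (auto intro!: eventually_ball_finite)
      then show ?thesis by (rule eventually_mono) (use c(1) in auto)
    qed
    obtain c where c: "\<And>n. c n \<in> tuples (length vs) M" "\<And>k. eventually (\<lambda>n. S k n (c n)) U"
      using diagonal_choice[OF U ne ev] by blast
    have "realizes upower vs (cls_tuple (length vs) c) \<Gamma>"
      unfolding realizes_def
    proof (clarify)
      fix \<psi> e assume \<gamma>: "(\<psi>, e) \<in> \<Gamma>"
      then obtain k where "from_nat_into (nrm ` \<Gamma>) k = nrm (\<psi>, e)"
        using from_nat_into_surj[OF cnt] by blast
      then have "nrm (g k) = nrm (\<psi>, e)" using g by simp
      then have "sat upower (assign e vs (cls_tuple (length vs) c)) \<psi> =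
         sat upower (assign (snd (g k)) vs (cls_tuple (length vs) c)) (fst (g k))"
        using nrm_sat[of \<psi> e _ _ "cls_tuple (length vs) c"] nrm_sat[of "fst (g k)" "snd (g k)" _ _ "cls_tuple (length vs) c"]
          cls_tuple_in_tuples[of c, OF c(1)] by (metis prod.collapse)
      then show "sat upower (assign e vs (cls_tuple (length vs) c)) \<psi>" using LS[where c = c, OF c(1)] c(2) by simp
    qed
    then show ?thesis using cls_tuple_in_tuples[of c, OF c(1)] by blast
  qed
qed

end

section \<open>Limits of bounded variation\<close>

text \<open>The set where a supremum of continuous functions exceeds \<open>c\<close> is the union of the open sets
  where one of them does.\<close>

lemma increasing_limit_semicont:
  assumes cont: "\<And>n. continuous_map X euclideanreal (A n)"
    and inc: "\<And>q. q \<in> topspace X \<Longrightarrow> incseq (\<lambda>n. A n q)"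
    and bd: "\<And>q n. q \<in> topspace X \<Longrightarrow> \<bar>A n q\<bar> \<le> K"
  shows "bounded_semicont X (\<lambda>q. SUP n. A n q)"
    and "\<And>q. q \<in> topspace X \<Longrightarrow> (\<lambda>n. A n q) \<longlonglongrightarrow> (SUP n. A n q)"
proof -
  have bdd: "bdd_above (range (\<lambda>n. A n q))" if "q \<in> topspace X" for q
  proof (rule bdd_aboveI2)
    fix n show "A n q \<le> K" using bd[OF that, of n] by simp
  qed
  show lim: "(\<lambda>n. A n q) \<longlonglongrightarrow> (SUP n. A n q)" if "q \<in> topspace X" for q
    by (rule LIMSEQ_incseq_SUP[OF bdd inc]) (rule that)+
  have "openin X {q \<in> topspace X. c < (SUP n. A n q)}" for c
  proof -
    have "{q \<in> topspace X. c < (SUP n. A n q)} = (\<Union>n. {q \<in> topspace X. A n q \<in> {c<..}})"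
      using bdd by (auto simp: less_cSUP_iff)
    moreover have "openin X {q \<in> topspace X. A n q \<in> {c<..}}" for n
      by (rule openin_continuous_map_preimage[OF cont]) simp
    ultimately show ?thesis by auto
  qed
  moreover have "\<bar>SUP n. A n q\<bar> \<le> K" if "q \<in> topspace X" for q
    by (rule LIMSEQ_le_const2[OF tendsto_rabs[OF lim[OF that]]]) (use bd[OF that] in auto)
  then have "bounded ((\<lambda>q. SUP n. A n q) ` topspace X)"
    by (auto simp: bounded_iff)
  ultimately show "bounded_semicont X (\<lambda>q. SUP n. A n q)"
    by (simp add: bounded_semicont_def lower_semicont_def)
qed

text \<open>The positive and the negative parts of the increments have bounded partial sums.  The
  limit is therefore the difference of two limits of increasing sequences of continuous functions.\<close>

lemma DBSC_bounded_variation: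
  assumes cont: "\<And>n. continuous_map X euclideanreal (g n)"
    and lim: "\<And>q. q \<in> topspace X \<Longrightarrow> (\<lambda>n. g n q) \<longlonglongrightarrow> f q"
    and var: "\<And>q N. q \<in> topspace X \<Longrightarrow> (\<Sum>n<N. \<bar>g (Suc n) q - g n q\<bar>) \<le> K"
    and bd: "\<And>q. q \<in> topspace X \<Longrightarrow> \<bar>g 0 q\<bar> \<le> C"
  shows "DBSC X f"
proof -
  define P where "P n q = max 0 (g (Suc n) q - g n q)" for n q
  define Q where "Q n q = max 0 (g n q - g (Suc n) q)" for n q
  define A where "A N q = g 0 q + (\<Sum>n<N. P n q)" for N q
  define B where "B N q = (\<Sum>n<N. Q n q)" for N q
  have AB: "A N q - B N q = g N q" for N q
    by (induction N) (auto simp: A_def B_def P_def Q_def)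
  have PQ: "P n q \<le> \<bar>g (Suc n) q - g n q\<bar>" "Q n q \<le> \<bar>g (Suc n) q - g n q\<bar>" "0 \<le> P n q" "0 \<le> Q n q" for n q
    by (auto simp: P_def Q_def)
  have s: "(\<Sum>n<N. P n q) \<le> K" "(\<Sum>n<N. Q n q) \<le> K" "0 \<le> (\<Sum>n<N. P n q)" "0 \<le> (\<Sum>n<N. Q n q)"
    if "q \<in> topspace X" for q N
    using order_trans[OF sum_mono var[OF that, of N], of "\<lambda>n. P n q"]
      order_trans[OF sum_mono var[OF that, of N], of "\<lambda>n. Q n q"]
    by (simp_all add: PQ sum_nonneg)
  have cA: "continuous_map X euclideanreal (A N)" and cB: "continuous_map X euclideanreal (B N)" for N
    unfolding A_def B_def P_def Q_def
    by (intro continuous_intros continuous_map_add continuous_map_sum continuous_map_real_max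
        continuous_map_diff cont; simp)+
  have iA: "incseq (\<lambda>n. A n q)" and iB: "incseq (\<lambda>n. B n q)" for q
    by (auto intro!: incseq_SucI simp: A_def B_def P_def Q_def)
  have bA: "\<bar>A n q\<bar> \<le> C + K" and bB: "\<bar>B n q\<bar> \<le> C + K" if "q \<in> topspace X" for q n
    using s[OF that, of n] bd[OF that] by (auto simp: A_def B_def)
  have SA: "bounded_semicont X (\<lambda>q. SUP n. A n q)"
    "\<And>q. q \<in> topspace X \<Longrightarrow> (\<lambda>n. A n q) \<longlonglongrightarrow> (SUP n. A n q)"
    by (rule increasing_limit_semicont[of X A "C + K"]; simp add: cA iA bA)+
  have SB: "bounded_semicont X (\<lambda>q. SUP n. B n q)"
    "\<And>q. q \<in> topspace X \<Longrightarrow> (\<lambda>n. B n q) \<longlonglongrightarrow> (SUP n. B n q)"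
    by (rule increasing_limit_semicont[of X B "C + K"]; simp add: cB iB bB)+
  have "f q = (SUP n. A n q) - (SUP n. B n q)" if q: "q \<in> topspace X" for q
    using LIMSEQ_unique[OF lim[OF q]] tendsto_diff[OF SA(2)[OF q] SB(2)[OF q]] unfolding AB by blast
  then show ?thesis unfolding DBSC_def using SA(1) SB(1) by blast
qed

section \<open>From NIP to DBSC definability\<close>

lemma assign_append_swap:
  assumes "distinct (xs @ ys)" "length a = length xs" "length b = length ys"
  shows "assign e (xs @ ys) (a @ b) = assign (assign e xs a) ys b"
proof
  fix v
  have "v \<notin> set xs \<or> v \<notin> set ys" using assms(1) by auto
  then show "assign e (xs @ ys) (a @ b) v = assign (assign e xs a) ys b v"
    unfolding assign_append[OF assms(2)]
    by (metis assign_in(2)[OF assms(2)] assign_in(2)[OF assms(3)] assign_notin)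
qed

text \<open>The values at finitely many parameter tuples are expressed by one formula, an existential
  statement about \<open>y\<close> in disjoint copies of the variables \<open>x\<close>, and an elementary
  embedding reflects it.  The variable \<open>prod_encode (0, v)\<close> stands for the member \<open>v\<close> of
  \<open>ys\<close>, and \<open>prod_encode (Suc i, v)\<close> for the \<open>i\<close>-th copy of any other variable
  \<open>v\<close>.\<close>

lemma opp_type_finite:
  assumes h: "elementary_embedding L h M N" and \<phi>: "is_formula L \<phi>" "fv \<phi> \<subseteq> set (xs @ ys)"
    and d: "distinct (xs @ ys)" and b: "b \<in> tuples (length ys) N"
    and as: "set as \<subseteq> tuples (length xs) M"
  shows "\<exists>b'\<in>tuples (length ys) M. \<forall>a\<in>set as. val M \<phi> xs ys a b' = val N \<phi> xs ys (map h a) b"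
proof -
  obtain u where u: "u \<in> universe M" using h by (auto simp: elementary_embedding_def is_structure_def)
  define yv where "yv v = prod_encode (0, v)" for v
  define \<pi> where "\<pi> i v = (if v \<in> set ys then yv v else prod_encode (Suc i, v))" for i v
  have inj: "inj (\<pi> i)" for i by (rule injI) (auto simp: \<pi>_def yv_def split: if_splits)
  define E where "E w = (case prod_decode w of (k, v) \<Rightarrow>
      if 0 < k \<and> k \<le> length as then assign (\<lambda>_. u) xs (as ! (k - 1)) v else u)" for w
  have E: "range E \<subseteq> universe M"
  proof
    fix x assume "x \<in> range E"
    then obtain w where w: "x = E w" by blast
    obtain k v where kv: "prod_decode w = (k, v)" by fastforce
    show "x \<in> universe M"
    proof (cases "0 < k \<and> k \<le> length as")
      case True
      then have "as ! (k - 1) \<in> tuples (length xs) M" using as by (auto simp: subset_eq)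
      then have "range (assign (\<lambda>_. u) xs (as ! (k - 1))) \<subseteq> universe M"
        by (intro assign_range) (use u in \<open>auto simp: tuples_def\<close>)
      then show ?thesis using True by (auto simp: w E_def kv)
    next
      case False
      then show ?thesis using u by (auto simp: w E_def kv)
    qed
  qed
  define \<theta> where "\<theta> i = (if val N \<phi> xs ys (map h (as ! i)) b = 0 then rename (\<pi> i) \<phi> else Neg (rename (\<pi> i) \<phi>))" for i
  define \<Theta> where "\<Theta> = Exs (map yv ys) (Conj (map \<theta> [0..<length as]))"
  have \<Theta>: "is_formula L \<Theta>" using \<phi>(1) by (auto simp: \<Theta>_def \<theta>_def is_formula_rename)
  have lb: "length b = length ys" using b by (simp add: tuples_def)
  have la: "length (as ! i) = length xs" if "i < length as" for i
    using as that nth_mem by (fastforce simp: tuples_def)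
  have eqv: "sat M' (\<lambda>v. E' (\<pi> i v)) \<phi> \<longleftrightarrow> val M' \<phi> xs ys a b' = 0"
    if "length a = length xs" "length b' = length ys"
      "\<And>v. v \<in> set xs \<Longrightarrow> v \<notin> set ys \<Longrightarrow> E' (prod_encode (Suc i, v)) = assign e' xs a v"
      "\<And>v. v \<in> set ys \<Longrightarrow> E' (yv v) = assign e'' ys b' v"
    for M' :: "('a, 'b, 'x) struct" and E' i a b' e' e''
  proof -
    have "sat M' (\<lambda>v. E' (\<pi> i v)) \<phi> = sat M' (assign (\<lambda>_. undefined) (xs @ ys) (a @ b')) \<phi>"
    proof (rule sat_cong)
      fix v assume "v \<in> fv \<phi>"
      then have "v \<in> set xs \<union> set ys" using \<phi>(2) by auto
      then show "E' (\<pi> i v) = assign (\<lambda>_. undefined) (xs @ ys) (a @ b') v"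
        unfolding assign_append_swap[OF d that(1,2)]
      proof (cases "v \<in> set ys")
        case True
        have "E' (\<pi> i v) = assign e'' ys b' v" using that(4)[OF True] by (simp add: \<pi>_def True)
        also have "\<dots> = assign (assign (\<lambda>_. undefined) xs a) ys b' v" by (rule assign_in(2)[OF that(2) True])
        finally show "E' (\<pi> i v) = assign (assign (\<lambda>_. undefined) xs a) ys b' v" .
      next
        case False
        then have v: "v \<in> set xs" using \<open>v \<in> set xs \<union> set ys\<close> by blast
        have "E' (\<pi> i v) = assign e' xs a v" using that(3)[OF v False] by (simp add: \<pi>_def False)
        also have "\<dots> = assign (\<lambda>_. undefined) xs a v" by (rule assign_in(2)[OF that(1) v])
        finally show "E' (\<pi> i v) = assign (assign (\<lambda>_. undefined) xs a) ys b' v"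
          by (simp add: assign_notin[OF False])
      qed
    qed
    then show ?thesis by (simp add: val_def)
  qed
  have "sat N (\<lambda>w. h (E w)) \<Theta>"
    unfolding \<Theta>_def sat_Exs
  proof (intro exI conjI)
    let ?E = "\<lambda>w. case prod_decode w of (k, v) \<Rightarrow> if k = 0 \<and> v \<in> set ys then assign (\<lambda>_. h u) ys b v else h (E w)"
    show "\<forall>v. v \<notin> set (map yv ys) \<longrightarrow> ?E v = h (E v)"
    proof (intro allI impI)
      fix w assume w: "w \<notin> set (map yv ys)"
      obtain k v where kv: "prod_decode w = (k, v)" by fastforce
      then have "w = prod_encode (k, v)" by (metis prod_decode_inverse)
      then show "?E w = h (E w)" using w by (auto simp: yv_def)
    qed
    show "\<forall>v\<in>set (map yv ys). ?E v \<in> universe N"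
      using assign_in(1)[OF lb] b by (auto simp: yv_def tuples_def)
    have "sat N ?E (\<theta> i)" if i: "i < length as" for i
    proof -
      have "sat N (\<lambda>v. ?E (\<pi> i v)) \<phi> \<longleftrightarrow> val N \<phi> xs ys (map h (as ! i)) b = 0"
      proof (rule eqv)
        fix v
        show "?E (prod_encode (Suc i, v)) = assign (\<lambda>_. h u) xs (map h (as ! i)) v"
          using i assign_map[of h "\<lambda>_. u" xs "as ! i" v] by (simp add: E_def)
      next
        fix v assume "v \<in> set ys"
        then show "?E (yv v) = assign (\<lambda>_. h u) ys b v" by (simp add: yv_def)
      qed (use la i lb in simp_all)
      then show ?thesis by (simp add: \<theta>_def sat_rename[OF inj])
    qed
    then show "sat N ?E (Conj (map \<theta> [0..<length as]))" by auto
  qed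
  then have "sat M E \<Theta>" using elementary_embeddingD[OF h \<Theta> E] by simp
  then obtain E' where E': "\<forall>v. v \<notin> set (map yv ys) \<longrightarrow> E' v = E v"
     "\<forall>v\<in>set (map yv ys). E' v \<in> universe M" "\<forall>i<length as. sat M E' (\<theta> i)"
    unfolding \<Theta>_def sat_Exs by auto
  define b' where "b' = map (\<lambda>v. E' (yv v)) ys"
  have b': "b' \<in> tuples (length ys) M" using E'(2) by (auto simp: b'_def tuples_def)
  have "val M \<phi> xs ys (as ! i) b' = val N \<phi> xs ys (map h (as ! i)) b" if i: "i < length as" for i
  proof -
    have "sat M (\<lambda>v. E' (\<pi> i v)) \<phi> \<longleftrightarrow> val M \<phi> xs ys (as ! i) b' = 0"
    proof (rule eqv)
      fix v
      have "prod_encode (Suc i, v) \<notin> set (map yv ys)" by (auto simp: yv_def)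
      then show "E' (prod_encode (Suc i, v)) = assign (\<lambda>_. u) xs (as ! i) v"
        using E'(1) i by (simp add: E_def)
    next
      fix v assume "v \<in> set ys"
      then show "E' (yv v) = assign undefined ys b' v"
        by (simp add: b'_def assign_def map_of_zip_map)
    qed (use la i b' in \<open>simp_all add: tuples_def\<close>)
    moreover have "sat M E' (\<theta> i)" using E'(3) i by blast
    ultimately have "val M \<phi> xs ys (as ! i) b' = 0 \<longleftrightarrow> val N \<phi> xs ys (map h (as ! i)) b = 0"
      by (simp add: \<theta>_def sat_rename[OF inj] split: if_splits)
    then show ?thesis by (auto simp: val_def split: if_splits)
  qed
  then show ?thesis using b' by (intro bexI[of _ b']) (auto simp: in_set_conv_nth)
qed

text \<open>By \<open>opp_type_finite\<close> the conditions that make up \<open>q\<close> are finitely satisfiable already in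
  \<open>M\<close>; they have parameters in the countable \<open>M\<close>, so saturation applies.\<close>

lemma opp_type_realized:
  assumes ext: "elementary_extension L M Ms" and sat: "saturated L Ms" and cM: "countable (universe M)"
    and \<phi>: "is_formula L \<phi>" "fv \<phi> \<subseteq> set (xs @ ys)" and d: "distinct (xs @ ys)"
    and q: "q \<in> opp_types L \<phi> xs ys M"
  obtains b where "b \<in> tuples (length ys) Ms" "opp_type_of \<phi> xs ys M Ms b = q"
proof -
  obtain N :: "('a, 'b, 'c) struct" and h b where h: "elementary_embedding L h M N" and b: "b \<in> tuples (length ys) N"
    and q: "q = (\<lambda>a\<in>tuples (length xs) M. val N \<phi> xs ys (map h a) b)"
    using q by (auto simp: opp_types_def)
  define \<gamma> where "\<gamma> a = (if val N \<phi> xs ys (map h a) b = 0 then \<phi> else Neg \<phi>, assign (\<lambda>_. undefined) xs a)" for a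
  define \<Gamma> where "\<Gamma> = \<gamma> ` tuples (length xs) M"
  have fvN: "fv (Neg \<phi>) = fv \<phi>" by (simp add: Neg_def)
  have sg: "(case \<gamma> a of (\<psi>, e) \<Rightarrow> sat Ms (assign e ys c) \<psi>) \<longleftrightarrow> val Ms \<phi> xs ys a c = val N \<phi> xs ys (map h a) b"
    if "a \<in> tuples (length xs) M" "c \<in> tuples (length ys) Ms" for a c
  proof -
    have "assign (\<lambda>_. undefined) (xs @ ys) (a @ c) = assign (assign (\<lambda>_. undefined) xs a) ys c"
      by (rule assign_append_swap[OF d]) (use that in \<open>auto simp: tuples_def\<close>)
    then show ?thesis by (auto simp: \<gamma>_def val_def)
  qed
  have "universe M \<subseteq> universe Ms" using ext by (simp add: elementary_extension_def)
  moreover have "\<Gamma> \<subseteq> formulas_over L (universe M) ys"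
  proof -
    have "assign (\<lambda>_. undefined) xs a v \<in> universe M"
      if "a \<in> tuples (length xs) M" "v \<in> fv \<phi> - set ys" for a v
    proof -
      have "v \<in> set xs" using that \<phi>(2) by auto
      then show ?thesis using assign_in(1)[of a xs v] that(1) by (auto simp: tuples_def)
    qed
    then show ?thesis using \<phi>(1) by (auto simp: \<Gamma>_def \<gamma>_def formulas_over_def fvN split: if_splits)
  qed
  moreover have "\<exists>c\<in>tuples (length ys) Ms. realizes Ms ys c \<Delta>" if \<Delta>: "finite \<Delta>" "\<Delta> \<subseteq> \<Gamma>" for \<Delta>
  proof -
    obtain A where A: "finite A" "A \<subseteq> tuples (length xs) M" "\<Delta> = \<gamma> ` A"
      using finite_subset_image[OF \<Delta>[unfolded \<Gamma>_def]] by blast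
    obtain as where as: "set as = A" using finite_list[OF A(1)] by blast
    obtain b' where b': "b' \<in> tuples (length ys) M" "\<forall>a\<in>A. val M \<phi> xs ys a b' = val N \<phi> xs ys (map h a) b"
      using opp_type_finite[OF h \<phi> d b, of as] A(2) as by blast
    have b'': "b' \<in> tuples (length ys) Ms" using elementary_extension_tuples[OF ext] b'(1) by blast
    have "val Ms \<phi> xs ys a b' = val N \<phi> xs ys (map h a) b" if "a \<in> A" for a
      using val_extension[OF ext \<phi> _ b'(1), of a] b'(2) A(2) that by auto
    then have "realizes Ms ys b' \<Delta>" using sg[OF _ b''] A(2) by (auto simp: realizes_def A(3) subset_eq)
    then show ?thesis using b'' by blast
  qed
  ultimately obtain c where c: "c \<in> tuples (length ys) Ms" "realizes Ms ys c \<Gamma>"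
    using sat[unfolded saturated_def, rule_format, of "universe M" ys \<Gamma>] cM d by auto
  have "opp_type_of \<phi> xs ys M Ms c = q"
    unfolding opp_type_of_def q
  proof (rule restrict_ext)
    fix a assume a: "a \<in> tuples (length xs) M"
    then have "case \<gamma> a of (\<psi>, e) \<Rightarrow> sat Ms (assign e ys c) \<psi>"
      using c(2) by (auto simp: realizes_def \<Gamma>_def)
    then show "val Ms \<phi> xs ys a c = val N \<phi> xs ys (map h a) b" using sg[OF a c(1)] by simp
  qed
  then show ?thesis using that c(1) by blast
qed

lemma opp_type_of_in_opp_types:
  assumes "elementary_extension L M Ms" "b \<in> tuples (length ys) Ms"
  shows "opp_type_of \<phi> xs ys M Ms b \<in> opp_types L \<phi> xs ys M"
  using assms unfolding opp_type_of_def opp_types_def elementary_extension_def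
  by (auto intro!: exI[of _ Ms] exI[of _ "\<lambda>u. u"] exI[of _ b])

text \<open>Two realizations of the same type over \<open>M\<close> are not separated by any element of \<open>M\<close>, hence
  not by \<open>p\<close>, which is finitely satisfiable in \<open>M\<close>.\<close>

lemma type_pair_val_realization:
  assumes fs: "finitely_satisfiable_in \<phi> xs ys M Ms p" and b: "b \<in> tuples (length ys) Ms"
  shows "type_pair_val \<phi> xs ys M Ms p (opp_type_of \<phi> xs ys M Ms b) = p b"
  unfolding type_pair_val_def
proof (rule the_equality)
  show "\<exists>c\<in>tuples (length ys) Ms. opp_type_of \<phi> xs ys M Ms c = opp_type_of \<phi> xs ys M Ms b \<and> p c = p b"
    using b by blast
  fix r assume "\<exists>c\<in>tuples (length ys) Ms. opp_type_of \<phi> xs ys M Ms c = opp_type_of \<phi> xs ys M Ms b \<and> p c = r"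
  then obtain c where c: "c \<in> tuples (length ys) Ms" "opp_type_of \<phi> xs ys M Ms c = opp_type_of \<phi> xs ys M Ms b" "p c = r"
    by blast
  obtain a where a: "a \<in> tuples (length xs) M" "p b = val Ms \<phi> xs ys a b" "p c = val Ms \<phi> xs ys a c"
    using fs[unfolded finitely_satisfiable_in_def, rule_format, of "{b, c}"] b c(1) by auto
  then show "r = p b"
    using fun_cong[OF c(2), of a] c(3) by (simp add: opp_type_of_def)
qed

lemma tuples_nonempty:
  assumes "universe M \<noteq> {}" shows "tuples n M \<noteq> {}"
proof -
  obtain u where "u \<in> universe M" using assms by blast
  then have "replicate n u \<in> tuples n M" by (auto simp: tuples_def)
  then show ?thesis by blast
qed

lemma countable_tuples: "countable (universe M) \<Longrightarrow> countable (tuples n M)"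
  by (rule countable_subset[of _ "lists (universe M)"]) (auto simp: tuples_def)

lemma NIP_no_shatter:
  fixes N :: "('f, 'r, 'u) struct"
  assumes nip: "NIP TYPE('u) L T \<phi> xs ys" and N: "is_model L T N"
  shows "\<exists>m. \<forall>as. set as \<subseteq> tuples (length xs) N \<longrightarrow> length as = m \<longrightarrow>
    \<not> shatters (\<lambda>a b. val N \<phi> xs ys a b = 0) (tuples (length ys) N) as"
proof (rule ccontr)
  let ?R = "\<lambda>a b. val N \<phi> xs ys a b = 0"
  assume neg: "\<not> ?thesis"
  have "has_IP TYPE('u) L T \<phi> xs ys"
    unfolding has_IP_def
  proof (intro exI[of _ N] conjI N allI)
    fix n :: nat
    obtain as where as: "set as \<subseteq> tuples (length xs) N" "length as = n"
      "shatters ?R (tuples (length ys) N) as"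
      using neg by blast
    have "\<forall>I. \<exists>b. b \<in> tuples (length ys) N \<and> (\<forall>i<n. ?R (as ! i) b \<longleftrightarrow> i \<in> I)"
      using as(2,3) unfolding shatters_def by blast
    then obtain b where b: "\<And>I. b I \<in> tuples (length ys) N" "\<And>I i. i < n \<Longrightarrow> ?R (as ! i) (b I) \<longleftrightarrow> i \<in> I"
      by metis
    have a: "as ! i \<in> tuples (length xs) N" if "i < n" for i using as(1,2) that nth_mem by blast
    show "\<exists>a b. (\<forall>i<n. a i \<in> tuples (length xs) N) \<and> (\<forall>I\<subseteq>{..<n}. b I \<in> tuples (length ys) N) \<and>
        (\<forall>i<n. \<forall>I\<subseteq>{..<n}. val N \<phi> xs ys (a i) (b I) = 0 \<longleftrightarrow> i \<in> I)"
      by (rule exI[of _ "\<lambda>i. as ! i"], rule exI[of _ b]) (simp add: a b)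
  qed
  then show False using nip by simp
qed

lemma val_01: "val M \<phi> xs ys a b = 0 \<or> val M \<phi> xs ys a b = 1"
  by (simp add: val_def)

text \<open>Finite satisfiability yields an ultrafilter on the tuples of \<open>M\<close> along which
  \<open>\<phi>(a, b)\<close> tends to \<open>p b\<close>.  NIP bounds the size of shattered sets, so
  \<open>generic_sequence\<close> provides a sequence in \<open>M\<close> that converges to \<open>p\<close> with bounded
  variation.  All this concerns tuples \<open>b\<close> of the extension; saturation carries it over to the
  whole type space.\<close>

lemma NIP_imp_DBSC_definable:
  fixes M Ms :: "('f, 'r, 'u) struct"
  assumes nip: "NIP TYPE('u) L T \<phi> xs ys" and mod: "is_model L T Ms"
    and ext: "elementary_extension L M Ms" and sat: "saturated L Ms" and cM: "countable (universe M)"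
    and \<phi>: "is_formula L \<phi>" "fv \<phi> \<subseteq> set (xs @ ys)" and d: "distinct (xs @ ys)"
    and fs: "finitely_satisfiable_in \<phi> xs ys M Ms p"
  shows "DBSC_definable L \<phi> xs ys M Ms p"
proof -
  define A where "A = tuples (length xs) M"
  define B where "B = tuples (length ys) Ms"
  define v where "v = val Ms \<phi> xs ys"
  define R where "R a b \<longleftrightarrow> v a b = 0" for a b
  obtain m where m: "\<forall>as. set as \<subseteq> tuples (length xs) Ms \<longrightarrow> length as = m \<longrightarrow>
    \<not> shatters (\<lambda>a b. val Ms \<phi> xs ys a b = 0) (tuples (length ys) Ms) as"
    using NIP_no_shatter[OF nip mod] ..
  have AMs: "A \<subseteq> tuples (length xs) Ms" unfolding A_def by (rule elementary_extension_tuples[OF ext])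
  have m': "\<not> shatters R B as" if "set as \<subseteq> A" "length as = m" for as
    using m[rule_format, of as] that AMs by (simp add: R_def[abs_def] B_def v_def)
  have "universe Ms \<noteq> {}" using mod by (simp add: is_model_def is_structure_def)
  then obtain b0 where b0: "b0 \<in> B" using tuples_nonempty[of Ms "length ys"] unfolding B_def by blast
  obtain U where U: "ultra U" "\<And>X. X \<in> (\<lambda>b. {a\<in>A. p b = v a b}) ` B \<Longrightarrow> eventually (\<lambda>x. x \<in> X) U"
  proof (rule FIP_ultrafilter)
    fix D assume D: "finite D" "D \<subseteq> (\<lambda>b. {a\<in>A. p b = v a b}) ` B"
    obtain B0 where B0: "finite B0" "B0 \<subseteq> B" "D = (\<lambda>b. {a\<in>A. p b = v a b}) ` B0"
      using finite_subset_image[OF D] by blast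
    then obtain a where "a \<in> A" "\<forall>b\<in>B0. p b = v a b"
      using fs unfolding finitely_satisfiable_in_def A_def B_def v_def by blast
    then have "a \<in> \<Inter>D" by (auto simp: B0(3))
    then show "\<Inter>D \<noteq> {}" by blast
  qed blast
  have Up: "eventually (\<lambda>a. a \<in> A \<and> p b = v a b) U" if "b \<in> B" for b
  proof -
    have "eventually (\<lambda>x. x \<in> {a\<in>A. p b = v a b}) U" by (rule U(2)) (rule imageI[OF that])
    then show ?thesis by simp
  qed
  have UA: "eventually (\<lambda>a. a \<in> A) U" using Up[OF b0] by (rule eventually_mono) simp
  have cA: "countable A" unfolding A_def by (rule countable_tuples[OF cM])
  obtain a where a: "\<And>n. a n \<in> A"
    and lim: "\<And>b. b \<in> B \<Longrightarrow> eventually (\<lambda>n. R (a n) b \<longleftrightarrow> eventually (\<lambda>x. R x b) U) sequentially"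
    and var: "\<And>b N. b \<in> B \<Longrightarrow> card {n. n < N \<and> R (a (Suc n)) b \<noteq> R (a n) b} \<le> 2 * m"
    using generic_sequence[where R = R and B = B, OF U(1) UA cA m'] by blast
  have conv: "(\<lambda>n. v (a n) b) \<longlonglongrightarrow> p b" if b: "b \<in> B" for b
  proof -
    have "eventually (\<lambda>n. v (a n) b = p b) sequentially"
    proof (cases "p b = 0")
      case True
      have "eventually (\<lambda>x. R x b) U" using Up[OF b] by (rule eventually_mono) (simp add: R_def True)
      with lim[OF b] show ?thesis by (simp add: R_def True)
    next
      case False
      have 1: "eventually (\<lambda>x. \<not> R x b) U" using Up[OF b] by (rule eventually_mono) (use False in \<open>simp add: R_def\<close>)
      have "eventually (\<lambda>x. p b = 1) U" using Up[OF b]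
        by (rule eventually_mono) (use False in \<open>auto simp: v_def val_def split: if_splits\<close>)
      then have p1: "p b = 1" using ultra_ex[OF U(1)] by blast
      have "\<not> eventually (\<lambda>x. R x b) U" using 1 ultra_not[OF U(1), of "\<lambda>x. R x b"] by simp
      then have "eventually (\<lambda>n. \<not> R (a n) b) sequentially" using lim[OF b] by simp
      then show ?thesis by (rule eventually_mono) (auto simp: R_def v_def val_def p1 split: if_splits)
    qed
    then show ?thesis by (rule tendsto_eventually)
  qed
  have variation: "(\<Sum>n<N. \<bar>v (a (Suc n)) b - v (a n) b\<bar>) \<le> 2 * m" if b: "b \<in> B" for b N
  proof -
    have "\<bar>v (a (Suc n)) b - v (a n) b\<bar> = (if R (a (Suc n)) b \<noteq> R (a n) b then 1 else 0)" for n
      by (simp add: R_def v_def val_def)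
    then have "(\<Sum>n<N. \<bar>v (a (Suc n)) b - v (a n) b\<bar>) = real (card {n. n < N \<and> R (a (Suc n)) b \<noteq> R (a n) b})"
      by (simp add: sum.If_cases Int_def)
    then show ?thesis using var[OF b, of N] by simp
  qed
  define f where "f = type_pair_val \<phi> xs ys M Ms p"
  let ?X = "opp_type_space L \<phi> xs ys M"
  have real: "\<exists>b\<in>B. (\<forall>n. q (a n) = v (a n) b) \<and> f q = p b" if q: "q \<in> opp_types L \<phi> xs ys M" for q
  proof -
    obtain b where b: "b \<in> tuples (length ys) Ms" "opp_type_of \<phi> xs ys M Ms b = q"
      by (rule opp_type_realized[OF ext sat cM \<phi> d q])
    have "f q = p b" using type_pair_val_realization[OF fs b(1)] by (simp add: f_def b(2))
    moreover have "q (a n) = v (a n) b" for n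
      using a[of n] by (simp add: b(2)[symmetric] opp_type_of_def A_def v_def)
    ultimately show ?thesis using b(1) by (auto simp: B_def)
  qed
  have qlim: "(\<lambda>n. q (a n)) \<longlonglongrightarrow> f q" if "q \<in> opp_types L \<phi> xs ys M" for q
    using real[OF that] conv by auto
  have "DBSC ?X f"
  proof (rule DBSC_bounded_variation)
    show "continuous_map ?X euclideanreal (\<lambda>q. q (a n))" for n
      unfolding opp_type_space_def
      by (rule continuous_map_from_subtopology, rule continuous_map_product_projection) (use a in \<open>simp add: A_def\<close>)
    show "(\<lambda>n. q (a n)) \<longlonglongrightarrow> f q" if "q \<in> topspace ?X" for q
      using qlim that by (simp add: topspace_opp_type_space)
    show "(\<Sum>n<N. \<bar>q (a (Suc n)) - q (a n)\<bar>) \<le> 2 * m" if "q \<in> topspace ?X" for q N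
      using real[of q] variation that by (auto simp: topspace_opp_type_space)
    show "\<bar>q (a 0)\<bar> \<le> 1" if "q \<in> topspace ?X" for q
    proof -
      have "q \<in> opp_types L \<phi> xs ys M" using that by (simp add: topspace_opp_type_space)
      then obtain b where "q (a 0) = v (a 0) b" using real by blast
      then show ?thesis using val_01[of Ms \<phi> xs ys "a 0" b] by (auto simp: v_def)
    qed
  qed
  then show ?thesis unfolding DBSC_definable_def
    using a qlim by (intro exI[of _ a] exI[of _ f]) (auto simp: A_def f_def)
qed

section \<open>From DBSC definability to few types\<close>

lemma nat_fun_lepoll_nat_set: "(UNIV :: (nat \<Rightarrow> nat) set) \<lesssim> (UNIV :: nat set set)"
  unfolding lepoll_def
proof (intro exI conjI)
  let ?g = "\<lambda>f :: nat \<Rightarrow> nat. range (\<lambda>n. prod_encode (n, f n))"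
  show "inj ?g"
  proof (rule injI, rule ext)
    fix f f' :: "nat \<Rightarrow> nat" and n assume "?g f = ?g f'"
    then have "prod_encode (n, f n) \<in> ?g f'" by blast
    then show "f n = f' n" by auto
  qed
qed simp

lemma sequences_lepoll:
  fixes X :: "'a set"
  assumes "countable X" shows "{f :: nat \<Rightarrow> 'a. range f \<subseteq> X} \<lesssim> (UNIV :: (nat \<Rightarrow> nat) set)"
  unfolding lepoll_def
proof (intro exI conjI)
  show "inj_on (\<lambda>f n. to_nat_on X (f n)) {f :: nat \<Rightarrow> 'a. range f \<subseteq> X}"
  proof (rule inj_onI, rule ext)
    fix f f' :: "nat \<Rightarrow> 'a" and n
    assume "f \<in> {f. range f \<subseteq> X}" "f' \<in> {f. range f \<subseteq> X}" and
      eq: "(\<lambda>n. to_nat_on X (f n)) = (\<lambda>n. to_nat_on X (f' n))"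
    then have "f n \<in> X" "f' n \<in> X" by auto
    then show "f n = f' n" using fun_cong[OF eq, of n] assms by simp
  qed
qed simp

text \<open>A DBSC definable type is the pointwise limit of a sequence of tuples of \<open>M\<close>, hence
  determined by this sequence, and there are only continuum many sequences.\<close>

lemma DBSC_definable_few:
  fixes M Ms :: "('f, 'r, 'u) struct"
  assumes ext: "elementary_extension L M Ms" and cM: "countable (universe M)"
    and df: "\<And>p. p \<in> P \<Longrightarrow> DBSC_definable L \<phi> xs ys M Ms p"
    and fs: "\<And>p. p \<in> P \<Longrightarrow> finitely_satisfiable_in \<phi> xs ys M Ms p"
    and P: "P \<subseteq> phi_types L \<phi> xs ys Ms"
  shows "P \<prec> (UNIV :: nat set set set)"
proof -
  have "\<exists>a. range a \<subseteq> tuples (length xs) M \<and>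
     (\<forall>b\<in>tuples (length ys) Ms. (\<lambda>n. opp_type_of \<phi> xs ys M Ms b (a n)) \<longlonglongrightarrow> p b)" if p: "p \<in> P" for p
  proof -
    obtain a f where a: "\<forall>n. a n \<in> tuples (length xs) M"
      "\<forall>q\<in>opp_types L \<phi> xs ys M. (\<lambda>n. q (a n)) \<longlonglongrightarrow> f q"
      "\<forall>q\<in>opp_types L \<phi> xs ys M. type_pair_val \<phi> xs ys M Ms p q = f q"
      using df[OF p] unfolding DBSC_definable_def by blast
    show ?thesis
    proof (intro exI conjI ballI)
      show "range a \<subseteq> tuples (length xs) M" using a(1) by blast
      fix b assume b: "b \<in> tuples (length ys) Ms"
      have q: "opp_type_of \<phi> xs ys M Ms b \<in> opp_types L \<phi> xs ys M"
        by (rule opp_type_of_in_opp_types[OF ext b])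
      show "(\<lambda>n. opp_type_of \<phi> xs ys M Ms b (a n)) \<longlonglongrightarrow> p b"
        using a(2,3) q type_pair_val_realization[OF fs[OF p] b] by metis
    qed
  qed
  then obtain a where a: "\<And>p. p \<in> P \<Longrightarrow> range (a p) \<subseteq> tuples (length xs) M"
     "\<And>p b. p \<in> P \<Longrightarrow> b \<in> tuples (length ys) Ms \<Longrightarrow> (\<lambda>n. opp_type_of \<phi> xs ys M Ms b (a p n)) \<longlonglongrightarrow> p b"
    by metis
  have inj: "inj_on a P"
  proof (rule inj_onI)
    fix p p' assume p: "p \<in> P" "p' \<in> P" and eq: "a p = a p'"
    show "p = p'"
    proof
      fix b
      show "p b = p' b"
      proof (cases "b \<in> tuples (length ys) Ms")
        case True
        then show ?thesis using a(2)[OF p(1) True] a(2)[OF p(2) True] unfolding eq by (auto intro: LIMSEQ_unique)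
      next
        case False
        have "\<exists>g. p = restrict g (tuples (length ys) Ms)" "\<exists>g. p' = restrict g (tuples (length ys) Ms)"
          using P p unfolding phi_types_def by blast+
        then show ?thesis using False by auto
      qed
    qed
  qed
  have "P \<lesssim> {f :: nat \<Rightarrow> 'u list. range f \<subseteq> tuples (length xs) M}"
    unfolding lepoll_def by (intro exI[of _ a] conjI) (use inj a(1) in auto)
  also have "\<dots> \<lesssim> (UNIV :: (nat \<Rightarrow> nat) set)"
    by (rule sequences_lepoll[OF countable_tuples[OF cM]])
  also have "\<dots> \<lesssim> (UNIV :: nat set set)" by (rule nat_fun_lepoll_nat_set)
  also have "(UNIV :: nat set set) \<prec> Pow (UNIV :: nat set set)" by (rule lesspoll_Pow_self)
  finally show ?thesis by simp
qed

section \<open>From the independence property to many types\<close>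

lemma sequence_coding:
  fixes X :: "'w set"
  assumes u: "(UNIV :: nat set set) \<lesssim> (UNIV :: 'u set)" and X: "X \<lesssim> (UNIV :: (nat \<Rightarrow> nat) set)"
  obtains j :: "(nat \<Rightarrow> 'w) \<Rightarrow> 'u" where "inj_on j {f. range f \<subseteq> X}"
proof -
  obtain i :: "'w \<Rightarrow> nat \<Rightarrow> nat" where i: "inj_on i X" using X by (auto simp: lepoll_def)
  have "{f :: nat \<Rightarrow> 'w. range f \<subseteq> X} \<lesssim> (UNIV :: (nat \<Rightarrow> nat) set)"
    unfolding lepoll_def
  proof (intro exI conjI)
    let ?g = "\<lambda>(f :: nat \<Rightarrow> 'w) n. case prod_decode n of (k, l) \<Rightarrow> i (f k) l"
    show "inj_on ?g {f. range f \<subseteq> X}"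
    proof (rule inj_onI, rule ext)
      fix f f' :: "nat \<Rightarrow> 'w" and k
      assume f: "f \<in> {f. range f \<subseteq> X}" "f' \<in> {f. range f \<subseteq> X}" and eq: "?g f = ?g f'"
      have "i (f k) l = i (f' k) l" for l using fun_cong[OF eq, of "prod_encode (k, l)"] by simp
      then have "i (f k) = i (f' k)" by (rule ext)
      then show "f k = f' k" using f by (intro inj_onD[OF i]) auto
    qed
  qed simp
  also have "\<dots> \<lesssim> (UNIV :: nat set set)" by (rule nat_fun_lepoll_nat_set)
  also have "\<dots> \<lesssim> (UNIV :: 'u set)" by (rule u)
  finally show ?thesis using that by (auto simp: lepoll_def)
qed

text \<open>Shattered sets of all finite sizes, together with the elements that cut out their
  subsets, lie in a countable model.  In its ultrapower the sequence \<open>\<alpha>\<close>, whose \<open>n\<close>-th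
  coordinates are the members of a shattered set of size \<open>n\<close>, has all its subsets cut out, even the
  infinite ones: \<open>\<beta> S\<close> cuts out \<open>S \<inter> {..<n}\<close> in the coordinate \<open>n\<close>.\<close>

lemma IP_saturated_model:
  fixes L :: "('f, 'r) language"
  assumes u: "(UNIV :: nat set set) \<lesssim> (UNIV :: 'u set)"
    and L: "countable_language L" and T: "\<forall>\<sigma>\<in>T. is_sentence L \<sigma>"
    and \<phi>: "is_formula L \<phi>" "fv \<phi> \<subseteq> set (xs @ ys)" and d: "distinct (xs @ ys)"
    and ip: "has_IP TYPE('u) L T \<phi> xs ys"
  shows "\<exists>(Ms :: ('f, 'r, 'u) struct) (\<alpha> :: nat \<Rightarrow> 'u list) (\<beta> :: nat set \<Rightarrow> 'u list).
    is_model L T Ms \<and> saturated L Ms \<and> universe Ms \<lesssim> (UNIV :: (nat \<Rightarrow> nat) set) \<and>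
    (\<forall>i. \<alpha> i \<in> tuples (length xs) Ms) \<and> (\<forall>S. \<beta> S \<in> tuples (length ys) Ms) \<and>
    (\<forall>i S. val Ms \<phi> xs ys (\<alpha> i) (\<beta> S) = 0 \<longleftrightarrow> i \<in> S)"
proof -
  obtain N :: "('f, 'r, 'u) struct" where N: "is_model L T N" and
     "\<forall>n::nat. \<exists>(a :: nat \<Rightarrow> 'u list) (b :: nat set \<Rightarrow> 'u list).
           (\<forall>i<n. a i \<in> tuples (length xs) N) \<and>
           (\<forall>I\<subseteq>{..<n}. b I \<in> tuples (length ys) N) \<and>
           (\<forall>i<n. \<forall>I\<subseteq>{..<n}. val N \<phi> xs ys (a i) (b I) = 0 \<longleftrightarrow> i \<in> I)"
    using ip unfolding has_IP_def by blast
  then obtain a :: "nat \<Rightarrow> nat \<Rightarrow> 'u list" and b :: "nat \<Rightarrow> nat set \<Rightarrow> 'u list"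
    where ab: "\<And>n. (\<forall>i<n. a n i \<in> tuples (length xs) N) \<and>
           (\<forall>I\<subseteq>{..<n}. b n I \<in> tuples (length ys) N) \<and>
           (\<forall>i<n. \<forall>I\<subseteq>{..<n}. val N \<phi> xs ys (a n i) (b n I) = 0 \<longleftrightarrow> i \<in> I)"
    by metis
  have sN: "is_structure L N" using N by (simp add: is_model_def)
  define C where "C = (\<Union>n. (\<Union>i\<in>{..<n}. set (a n i)) \<union> (\<Union>I\<in>Pow {..<n}. set (b n I)))"
  have cC: "countable C" unfolding C_def
    by (intro countable_UN countable_Un; simp add: countable_finite)
  have aN: "a n i \<in> tuples (length xs) N" if "i < n" for n i using ab[of n] that by blast
  have bN: "b n I \<in> tuples (length ys) N" if "I \<subseteq> {..<n}" for n I using ab[of n] that by blast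
  have "C \<subseteq> universe N"
    unfolding C_def
  proof (intro UN_least Un_least)
    show "set (a n i) \<subseteq> universe N" if "i \<in> {..<n}" for n i using aN[of i n] that by (simp add: tuples_def)
    show "set (b n I) \<subseteq> universe N" if "I \<in> Pow {..<n}" for n I using bN[of I n] that by (simp add: tuples_def)
  qed
  then obtain K where K: "C \<subseteq> K" "countable K" "elementary_extension L (N\<lparr>universe := K\<rparr>) N"
    using downward_loewenheim_skolem[OF L sN cC] by blast
  define N0 where "N0 = N\<lparr>universe := K\<rparr>"
  have e0: "elementary_extension L N0 N" using K(3) by (simp add: N0_def)
  have m0: "is_model L T N0"
    using elementary_embedding_model[of L "\<lambda>u. u" N0 N T] e0 T N by (simp add: elementary_extension_def)
  have aK: "a n i \<in> tuples (length xs) N0" if "i < n" for n i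
  proof -
    have "set (a n i) \<subseteq> C" unfolding C_def using that by blast
    then show ?thesis using aN[OF that] K(1) by (auto simp: tuples_def N0_def)
  qed
  have bK: "b n I \<in> tuples (length ys) N0" if "I \<subseteq> {..<n}" for n I
  proof -
    have "set (b n I) \<subseteq> C" unfolding C_def using that by blast
    then show ?thesis using bN[OF that] K(1) by (auto simp: tuples_def N0_def)
  qed
  have v0: "val N0 \<phi> xs ys (a n i) (b n I) = 0 \<longleftrightarrow> i \<in> I" if "i < n" "I \<subseteq> {..<n}" for n i I
  proof -
    have "val N \<phi> xs ys (a n i) (b n I) = 0 \<longleftrightarrow> i \<in> I" using ab[of n] that by blast
    then show ?thesis using val_extension[OF e0 \<phi> aK[OF that(1)] bK[OF that(2)]] by simp
  qed
  obtain U :: "nat filter" where U: "ultra U" "U \<le> sequentially" by (rule nonprincipal_ultrafilter)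
  have KK: "K \<lesssim> (UNIV :: (nat \<Rightarrow> nat) set)"
    unfolding lepoll_def
  proof (intro exI conjI)
    show "inj_on (\<lambda>k (n :: nat). to_nat_on K k) K"
      using inj_on_to_nat_on[OF K(2)] by (auto simp: inj_on_def fun_eq_iff)
  qed simp
  obtain j :: "(nat \<Rightarrow> 'u) \<Rightarrow> 'u" where j: "inj_on j {f. range f \<subseteq> K}"
    by (rule sequence_coding[OF u KK])
  interpret P: ultrapower L N0 U j
    by unfold_locales (use U m0 j in \<open>simp_all add: is_model_def N0_def\<close>)
  obtain w where w: "w \<in> tuples (length xs) N0"
    using tuples_nonempty[of N0 "length xs"] m0 by (auto simp: is_model_def is_structure_def)
  \<comment> \<open>Coordinates up to \<open>i\<close> of the member \<open>i\<close> of the sequence are filled arbitrarily.\<close>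
  define a' where "a' i n = (if i < n then a n i else w)" for i n
  have a': "a' i n \<in> tuples (length xs) N0" for i n using aK w by (simp add: a'_def)
  define \<alpha> where "\<alpha> i = P.cls_tuple (length xs) (a' i)" for i
  define \<beta> where "\<beta> S = P.cls_tuple (length ys) (\<lambda>n. b n (S \<inter> {..<n}))" for S
  have bb: "b n (S \<inter> {..<n}) \<in> tuples (length ys) N0" for n S by (rule bK) simp
  show ?thesis
  proof (intro exI[of _ P.upower] exI[of _ \<alpha>] exI[of _ \<beta>] conjI allI)
    show "is_model L T P.upower"
      using elementary_embedding_model[OF P.elementary_diagonal T] m0 by simp
    show "saturated L P.upower" by (rule P.saturated_upower[OF L U(2)])
    have "universe P.upower \<lesssim> {f :: nat \<Rightarrow> 'u. range f \<subseteq> universe N0}"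
      unfolding P.upower_universe P.seqs_def by (rule image_lepoll)
    also have "\<dots> \<lesssim> (UNIV :: (nat \<Rightarrow> nat) set)" by (rule sequences_lepoll) (simp add: N0_def K(2))
    finally show "universe P.upower \<lesssim> (UNIV :: (nat \<Rightarrow> nat) set)" .
    show "\<alpha> i \<in> tuples (length xs) P.upower" for i unfolding \<alpha>_def by (rule P.cls_tuple_in_tuples) (rule a')
    show "\<beta> S \<in> tuples (length ys) P.upower" for S unfolding \<beta>_def by (rule P.cls_tuple_in_tuples) (rule bb)
    show "val P.upower \<phi> xs ys (\<alpha> i) (\<beta> S) = 0 \<longleftrightarrow> i \<in> S" for i S
    proof -
      have big: "eventually (\<lambda>n. i < n) U" using eventually_gt_at_top[of i] U(2) by (rule filter_leD[rotated])
      have "val P.upower \<phi> xs ys (\<alpha> i) (\<beta> S) = 0 \<longleftrightarrow>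
          eventually (\<lambda>n. val N0 \<phi> xs ys (a' i n) (b n (S \<inter> {..<n})) = 0) U"
        unfolding \<alpha>_def \<beta>_def by (rule P.los_val[OF \<phi> d a' bb])
      also have "\<dots> \<longleftrightarrow> eventually (\<lambda>n. i \<in> S) U"
        by (rule eventually_cong[OF big]) (simp add: a'_def v0)
      also have "\<dots> \<longleftrightarrow> i \<in> S" using U(1) by (simp add: eventually_const ultra_def)
      finally show ?thesis .
    qed
  qed
qed

text \<open>The limit type along \<open>V\<close> is realized in the ultrapower by \<open>V\<close>, by the class of the
  sequence \<open>\<alpha>\<close> itself.\<close>

lemma ultrafilter_type:
  fixes Ms :: "('f, 'r, 'u) struct"
  assumes u: "(UNIV :: nat set set) \<lesssim> (UNIV :: 'u set)"
    and Ms: "is_structure L Ms" and card: "universe Ms \<lesssim> (UNIV :: (nat \<Rightarrow> nat) set)"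
    and \<phi>: "is_formula L \<phi>" "fv \<phi> \<subseteq> set (xs @ ys)" and d: "distinct (xs @ ys)"
    and \<alpha>: "\<And>i. \<alpha> i \<in> tuples (length xs) Ms" and V: "ultra (V :: nat filter)"
  shows "(\<lambda>b\<in>tuples (length ys) Ms. if eventually (\<lambda>i. val Ms \<phi> xs ys (\<alpha> i) b = 0) V then 0 else 1)
    \<in> phi_types L \<phi> xs ys Ms"
proof -
  obtain j :: "(nat \<Rightarrow> 'u) \<Rightarrow> 'u" where j: "inj_on j {f. range f \<subseteq> universe Ms}"
    by (rule sequence_coding[OF u card])
  interpret Q: ultrapower L Ms V j by unfold_locales (use V Ms j in simp_all)
  let ?h = "\<lambda>u. Q.cls (\<lambda>_. u)"
  let ?a = "Q.cls_tuple (length xs) \<alpha>"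
  have "(if eventually (\<lambda>i. val Ms \<phi> xs ys (\<alpha> i) b = 0) V then 0 else 1) = val Q.upower \<phi> xs ys ?a (map ?h b)"
    if b: "b \<in> tuples (length ys) Ms" for b
  proof -
    have "map ?h b = Q.cls_tuple (length ys) (\<lambda>_. b)"
      using b by (auto simp: Q.cls_tuple_def tuples_def intro!: nth_equalityI)
    then have "val Q.upower \<phi> xs ys ?a (map ?h b) = 0 \<longleftrightarrow> eventually (\<lambda>i. val Ms \<phi> xs ys (\<alpha> i) b = 0) V"
      using Q.los_val[OF \<phi> d \<alpha>, of "\<lambda>_. b"] b by simp
    then show ?thesis using val_01[of Q.upower \<phi> xs ys ?a "map ?h b"] by auto
  qed
  then have "(\<lambda>b\<in>tuples (length ys) Ms. if eventually (\<lambda>i. val Ms \<phi> xs ys (\<alpha> i) b = 0) V then 0 else 1)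
     = (\<lambda>b\<in>tuples (length ys) Ms. val Q.upower \<phi> xs ys ?a (map ?h b))"
    by (intro restrict_ext) auto
  moreover have "?a \<in> tuples (length xs) Q.upower" by (rule Q.cls_tuple_in_tuples) (rule \<alpha>)
  ultimately show ?thesis unfolding phi_types_def using Q.elementary_diagonal by blast
qed

text \<open>Any countable elementary substructure that contains the sequence \<open>\<alpha>\<close> serves as \<open>M\<close>.
  The limit type along an ultrafilter \<open>V\<close> is finitely satisfiable in \<open>\<alpha>\<close>, and its value
  at \<open>\<beta> S\<close> tells whether \<open>S\<close> belongs to \<open>V\<close>.\<close>

lemma IP_imp_many:
  fixes L :: "('f, 'r) language"
  assumes u: "(UNIV :: nat set set) \<lesssim> (UNIV :: 'u set)"
    and L: "countable_language L" and T: "\<forall>\<sigma>\<in>T. is_sentence L \<sigma>"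
    and \<phi>: "is_formula L \<phi>" "fv \<phi> \<subseteq> set (xs @ ys)" and d: "distinct (xs @ ys)"
    and ip: "has_IP TYPE('u) L T \<phi> xs ys"
  shows "\<exists>M Ms :: ('f, 'r, 'u) struct. is_model L T M \<and> countable (universe M) \<and>
    elementary_extension L M Ms \<and> saturated L Ms \<and>
    (UNIV :: nat set set set) \<lesssim> {p \<in> phi_types L \<phi> xs ys Ms. finitely_satisfiable_in \<phi> xs ys M Ms p}"
proof -
  obtain Ms :: "('f, 'r, 'u) struct" and \<alpha> :: "nat \<Rightarrow> 'u list"
    and \<beta> :: "nat set \<Rightarrow> 'u list" where Ms: "is_model L T Ms" "saturated L Ms"
    and card: "universe Ms \<lesssim> (UNIV :: (nat \<Rightarrow> nat) set)"
    and \<alpha>: "\<And>i. \<alpha> i \<in> tuples (length xs) Ms" and \<beta>: "\<And>S. \<beta> S \<in> tuples (length ys) Ms"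
    and v: "\<And>i S. val Ms \<phi> xs ys (\<alpha> i) (\<beta> S) = 0 \<longleftrightarrow> i \<in> S"
    using IP_saturated_model[OF u L T \<phi> d ip] by blast
  have sMs: "is_structure L Ms" using Ms by (simp add: is_model_def)
  have "countable (\<Union>i. set (\<alpha> i))" "(\<Union>i. set (\<alpha> i)) \<subseteq> universe Ms"
    using \<alpha> by (auto simp: tuples_def countable_finite)
  then obtain K where K: "(\<Union>i. set (\<alpha> i)) \<subseteq> K" "countable K" "elementary_extension L (Ms\<lparr>universe := K\<rparr>) Ms"
    using downward_loewenheim_skolem[OF L sMs] by blast
  define M where "M = Ms\<lparr>universe := K\<rparr>"
  have ext: "elementary_extension L M Ms" using K(3) by (simp add: M_def)
  have mM: "is_model L T M"
    using elementary_embedding_model[of L "\<lambda>u. u" M Ms T] ext T Ms by (simp add: elementary_extension_def)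
  have \<alpha>M: "\<alpha> i \<in> tuples (length xs) M" for i using \<alpha>[of i] K(1) by (auto simp: tuples_def M_def)
  obtain V :: "nat set set \<Rightarrow> nat filter" where V: "\<And>W. ultra (V W)"
     "\<And>W X. eventually (\<lambda>n. n \<in> trace_test X) (V W) \<longleftrightarrow> X \<in> W"
    using many_ultrafilters by blast
  define p where "p W = (\<lambda>b\<in>tuples (length ys) Ms.
      if eventually (\<lambda>i. val Ms \<phi> xs ys (\<alpha> i) b = 0) (V W) then 0 else 1 :: real)" for W
  have pt: "p W \<in> phi_types L \<phi> xs ys Ms" for W
    unfolding p_def by (rule ultrafilter_type[OF u sMs card \<phi> d \<alpha> V(1)])
  have pf: "finitely_satisfiable_in \<phi> xs ys M Ms (p W)" for W
    unfolding finitely_satisfiable_in_def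
  proof (intro allI impI, elim conjE)
    fix B assume B: "finite B" "B \<subseteq> tuples (length ys) Ms"
    have "eventually (\<lambda>i. \<forall>b\<in>B. p W b = val Ms \<phi> xs ys (\<alpha> i) b) (V W)"
    proof (rule eventually_ball_finite[OF B(1)], rule ballI)
      fix b assume "b \<in> B"
      then have b: "b \<in> tuples (length ys) Ms" using B(2) by blast
      show "eventually (\<lambda>i. p W b = val Ms \<phi> xs ys (\<alpha> i) b) (V W)"
      proof (cases "eventually (\<lambda>i. val Ms \<phi> xs ys (\<alpha> i) b = 0) (V W)")
        case True
        then show ?thesis by (rule eventually_mono) (simp add: p_def b True)
      next
        case False
        then have "eventually (\<lambda>i. val Ms \<phi> xs ys (\<alpha> i) b \<noteq> 0) (V W)" by (simp add: ultra_not[OF V(1)])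
        then show ?thesis
          by (rule eventually_mono) (use False in \<open>auto simp: p_def b val_def split: if_splits\<close>)
      qed
    qed
    then obtain i where "\<forall>b\<in>B. p W b = val Ms \<phi> xs ys (\<alpha> i) b" using ultra_ex[OF V(1)] by blast
    then show "\<exists>a\<in>tuples (length xs) M. \<forall>b\<in>B. p W b = val Ms \<phi> xs ys a b" using \<alpha>M by blast
  qed
  have pW: "p W (\<beta> (trace_test X)) = 0 \<longleftrightarrow> X \<in> W" for W X
    using V(2)[of X W] \<beta> by (simp add: p_def v)
  have inj: "inj p"
  proof (rule injI)
    fix W W' assume eq: "p W = p W'"
    have "X \<in> W \<longleftrightarrow> X \<in> W'" for X using pW[of W X] pW[of W' X] by (simp add: eq)
    then show "W = W'" by blast
  qed
  have "(UNIV :: nat set set set) \<lesssim> {p \<in> phi_types L \<phi> xs ys Ms. finitely_satisfiable_in \<phi> xs ys M Ms p}"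
    unfolding lepoll_def by (intro exI[of _ p] conjI) (use inj pt pf in auto)
  moreover have "countable (universe M)" using K(2) by (simp add: M_def)
  ultimately show ?thesis using mM ext Ms(2) by blast
qed

theorem corollary4p13:
  fixes L :: "('f, 'r) language" and T :: "('f, 'r) fm set"
    and \<phi> :: "('f, 'r) fm" and xs ys :: "nat list"
  assumes "(UNIV :: nat set set) \<lesssim> (UNIV :: 'u set)"
    and "countable_language L"
    and "complete_theory TYPE('u) L T"
    and "is_formula L \<phi>"
    and "distinct (xs @ ys)"
    and "fv \<phi> \<subseteq> set (xs @ ys)"
  shows
    "(NIP TYPE('u) L T \<phi> xs ys \<longleftrightarrow>
       (\<forall>M Ms :: ('f, 'r, 'u) struct.
          is_model L T M \<and> countable (universe M) \<and>
          elementary_extension L M Ms \<and> saturated L Ms \<longrightarrow>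
          (\<forall>p\<in>phi_types L \<phi> xs ys Ms.
             finitely_satisfiable_in \<phi> xs ys M Ms p \<longrightarrow>
             DBSC_definable L \<phi> xs ys M Ms p)))
     \<and>
     (NIP TYPE('u) L T \<phi> xs ys \<longleftrightarrow>
       (\<forall>M Ms :: ('f, 'r, 'u) struct.
          is_model L T M \<and> countable (universe M) \<and>
          elementary_extension L M Ms \<and> saturated L Ms \<longrightarrow>
          {p \<in> phi_types L \<phi> xs ys Ms. finitely_satisfiable_in \<phi> xs ys M Ms p}
            \<prec> (UNIV :: nat set set set)))"
    (is "(?i \<longleftrightarrow> ?ii) \<and> (?i \<longleftrightarrow> ?iii)")
proof -
  have T: "\<forall>\<sigma>\<in>T. is_sentence L \<sigma>" using assms(3) by (simp add: complete_theory_def)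
  have "?i \<Longrightarrow> ?ii"
  proof (intro allI impI ballI, elim conjE)
    fix M Ms :: "('f, 'r, 'u) struct" and p
    assume nip: ?i and M: "is_model L T M" "countable (universe M)" "elementary_extension L M Ms" "saturated L Ms"
      and p: "finitely_satisfiable_in \<phi> xs ys M Ms p"
    have "is_model L T Ms"
      using elementary_embedding_model[of L "\<lambda>u. u" M Ms T] M T by (simp add: elementary_extension_def)
    then show "DBSC_definable L \<phi> xs ys M Ms p"
      by (rule NIP_imp_DBSC_definable[OF nip _ M(3,4,2) assms(4,6,5) p])
  qed
  moreover have "?ii \<Longrightarrow> ?iii"
  proof (intro allI impI, elim conjE)
    fix M Ms :: "('f, 'r, 'u) struct"
    assume ii: ?ii and M: "is_model L T M" "countable (universe M)" "elementary_extension L M Ms" "saturated L Ms"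
    let ?P = "{p \<in> phi_types L \<phi> xs ys Ms. finitely_satisfiable_in \<phi> xs ys M Ms p}"
    show "?P \<prec> (UNIV :: nat set set set)"
    proof (rule DBSC_definable_few[OF M(3,2)])
      show "DBSC_definable L \<phi> xs ys M Ms p" if "p \<in> ?P" for p
        using ii[rule_format, of M Ms p] M that by simp
    qed auto
  qed
  moreover have "?iii \<Longrightarrow> ?i"
  proof
    assume iii: ?iii and "has_IP TYPE('u) L T \<phi> xs ys"
    then obtain M Ms :: "('f, 'r, 'u) struct" where M: "is_model L T M \<and> countable (universe M) \<and>
      elementary_extension L M Ms \<and> saturated L Ms" and
      big: "(UNIV :: nat set set set) \<lesssim> {p \<in> phi_types L \<phi> xs ys Ms. finitely_satisfiable_in \<phi> xs ys M Ms p}"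
      using IP_imp_many[OF assms(1,2) T assms(4,6,5)] by blast
    have "{p \<in> phi_types L \<phi> xs ys Ms. finitely_satisfiable_in \<phi> xs ys M Ms p} \<prec> (UNIV :: nat set set set)"
      using iii M by blast
    with big show False using lesspoll_trans2 lesspoll_not_refl by blast
  qed
  ultimately show ?thesis by blast
qed

end
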